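(* Two modular geodesics of the same length $2\sinh^{-1}(\sqrt{\Delta}/2)$ are $\mathbb{K}$-equivalent if and only if we have one of the following equivalent conditions: ($\theta$) There exists one intersection point with angle $\theta\in\,]0,\pi[$ such that $\left(\cos\tfrac{\theta}{2}\right)^2=\frac{1}{(2x)^2-\Delta y^2}$ for $x,y\in\mathbb{K}$, in which case all intersection points have this property. ($\lambda$) There exists one co-oriented ortho-geodesic of length $\lambda$ such that $\left(\cosh\tfrac{\lambda}{2}\right)^2=\frac{1}{(2x)^2-\Delta y^2}$ for $x,y\in\mathbb{K}$, in which case all co-oriented ortho-geodesics have this property.
   Context: $\mathbb{K}$ is a field of characteristic different from $2$. An integral binary quadratic form is $Q=lx^2+mxy+ry^2$ with $l,m,r\in\mathbb{Z}$; it is primitive if $\gcd(l,m,r)=1$; its discriminant is $m^2-4lr$. The setting is that of primitive integral binary quadratic forms $Q_a,Q_b$ with the same non-square discriminant $\Delta>0$, with $\sqrt{\Delta}>0$. The modular orbifold is $\mathbb{M}=\mathrm{PSL}_2(\mathbb{Z})\backslash\mathbb{H}$, where $\mathbb{H}$ is the hyperbolic upper half-plane on which $\mathrm{PSL}_2(\mathbb{Z})$ acts by linear fractional transformations. A form $Q$ of discriminant $\Delta$ corresponds to the oriented geodesic of $\mathbb{H}$ from $\alpha'=\frac{-m-\sqrt\Delta}{2l}$ to $\alpha=\frac{-m+\sqrt\Delta}{2l}$. The $\mathrm{PSL}_2(\mathbb{Z})$-classes of $Q_a,Q_b$ correspond to primitive closed oriented geodesics in $\mathbb{M}$, called modular geodesics,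 whose length is taken to be $2\sinh^{-1}(\sqrt{\Delta}/2)$. Write $(\alpha',\alpha)$ and $(\beta',\beta)$ for oriented lifts to $\mathbb{H}$ of the two modular geodesics. Intersection points correspond to pairs of lifts, one of each, which cross in $\mathbb{H}$, modulo the diagonal action of $\mathrm{PSL}_2(\mathbb{Z})$; $\theta\in\,]0,\pi[$ is the angle between the directions of the two oriented lifts. Ortho-geodesics correspond to pairs of lifts which do not intersect, modulo $\mathrm{PSL}_2(\mathbb{Z})$; $\lambda$ is the length of their unique common perpendicular geodesic arc. An ortho-geodesic is co-oriented when the arc receives compatible co-orientations from the two oriented lifts, i.e. both lifts cross the complete geodesic carrying the arc from the same side to the same other side. In terms of the cross-ratio $\mathrm{bir}=\frac{(\alpha-\alpha')(\beta-\beta')}{(\alpha-\beta')(\beta-\alpha')}$ one has $\left(\cos\tfrac{\theta}{2}\right)^2=\frac{1}{\mathrm{bir}}$ in the first case and $\left(\cosh\tfrac{\lambda}{2}\right)^2=\frac{1}{\mathrm{bir}}$ in the second (co-oriented) case. Two modular geodesics are $\mathbb{K}$-equivalent when the corresponding quadratic forms, after extension of scalars from $\mathbb{Z}$ to $\mathbb{K}$, lie in the same orbit of $\mathrm{PSL}_2(\mathbb{K})$ acting by linear change of variables.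
   Formalization: In positive characteristic the claim fails or is undefined (e.g. Δ=12 over F_3; Δ=8 over F_7), so Δ is assumed nonzero in K, the real number is replaced by the image in K of that rational number, and 1/0 is read as 0; in characteristic 0 nothing changes. *)

theory Defs
  imports "HOL-Analysis.Analysis"
begin

section \<open>Binary quadratic forms\<close>

text \<open>\<open>BQF l m r\<close> is the form \<open>l x\<^sup>2 + m x y + r y\<^sup>2\<close>. Extension of scalars from the integers
  to a ring is \<open>map_bqf of_int\<close>.\<close>

datatype 'a bqf = BQF (coeff_xx: 'a) (coeff_xy: 'a) (coeff_yy: 'a)

definition bqf_eval :: "'a::comm_ring_1 bqf \<Rightarrow> 'a \<Rightarrow> 'a \<Rightarrow> 'a" where
  "bqf_eval Q x y = coeff_xx Q * x^2 + coeff_xy Q * x * y + coeff_yy Q * y^2"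

definition disc :: "'a::comm_ring_1 bqf \<Rightarrow> 'a" where
  "disc Q = (coeff_xy Q)^2 - 4 * coeff_xx Q * coeff_yy Q"

definition primitive :: "int bqf \<Rightarrow> bool" where
  "primitive Q \<longleftrightarrow> Gcd {coeff_xx Q, coeff_xy Q, coeff_yy Q} = 1"

text \<open>Same orbit under linear changes of variables of determinant 1. Since \<open>-1\<close> acts trivially,
  the orbits of \<open>SL\<^sub>2\<close> are those of \<open>PSL\<^sub>2 = SL\<^sub>2 / {1, -1}\<close>. Over any ring the values at
  \<open>(1,0)\<close>, \<open>(0,1)\<close>, \<open>(1,1)\<close> determine the coefficients, so that equality of forms may be tested
  on values.\<close>

definition psl2_equivalent :: "'a::comm_ring_1 bqf \<Rightarrow> 'a bqf \<Rightarrow> bool" where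
  "psl2_equivalent F G \<longleftrightarrow> (\<exists>M :: 'a^2^2. det M = 1 \<and>
     (\<forall>x y. bqf_eval G x y = bqf_eval F (M$1$1 * x + M$1$2 * y) (M$2$1 * x + M$2$2 * y)))"

definition K_equivalent :: "'k::field itself \<Rightarrow> int bqf \<Rightarrow> int bqf \<Rightarrow> bool" where
  "K_equivalent _ Qa Qb \<longleftrightarrow>
     psl2_equivalent (map_bqf of_int Qa :: 'k bqf) (map_bqf of_int Qb :: 'k bqf)"

section \<open>Oriented geodesics of the upper half-plane\<close>

text \<open>Unit speed parametrisations of complete geodesics: the images of \<open>t \<mapsto> i e\<^sup>t\<close>
  under \<open>SL\<^sub>2(\<real>)\<close>, which acts simply transitively modulo \<open>{1, -1}\<close> on unit tangent vectors.\<close>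

definition hyp_geodesic :: "(real \<Rightarrow> complex) \<Rightarrow> bool" where
  "hyp_geodesic \<gamma> \<longleftrightarrow> (\<exists>M :: real^2^2. det M = 1 \<and>
     \<gamma> = (\<lambda>t. moebius (of_real (M$1$1)) (of_real (M$1$2)) (of_real (M$2$1)) (of_real (M$2$2))
              (\<i> * of_real (exp t))))"

text \<open>An oriented geodesic with real endpoints is represented by the pair
  (initial endpoint, final endpoint).\<close>

definition geodesic_with_ends :: "real \<times> real \<Rightarrow> (real \<Rightarrow> complex) \<Rightarrow> bool" where
  "geodesic_with_ends A \<gamma> \<longleftrightarrow> hyp_geodesic \<gamma> \<and>
     (\<gamma> \<longlongrightarrow> of_real (fst A)) at_bot \<and> (\<gamma> \<longlongrightarrow> of_real (snd A)) at_top"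

definition velocity :: "(real \<Rightarrow> complex) \<Rightarrow> real \<Rightarrow> complex" where
  "velocity \<gamma> t = vector_derivative \<gamma> (at t)"

text \<open>The half-plane model is conformal: hyperbolic angles between tangent vectors are the
  Euclidean ones.\<close>

definition vec_angle :: "complex \<Rightarrow> complex \<Rightarrow> real" where
  "vec_angle u v = arccos ((u \<bullet> v) / (norm u * norm v))"

definition crossing_angle :: "real \<times> real \<Rightarrow> real \<times> real \<Rightarrow> real \<Rightarrow> bool" where
  "crossing_angle A B \<theta> \<longleftrightarrow> 0 < \<theta> \<and> \<theta> < pi \<and>
     (\<exists>\<gamma> \<delta> s t. geodesic_with_ends A \<gamma> \<and> geodesic_with_ends B \<delta> \<and> \<gamma> s = \<delta> t \<and>
        \<theta> = vec_angle (velocity \<gamma> s) (velocity \<delta> t))"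

text \<open>The arc is \<open>\<sigma>\<close> restricted to \<open>{0..ell}\<close>; its length is \<open>ell\<close> because \<open>\<sigma>\<close> has unit speed.
  A curve crosses \<open>\<sigma>\<close> from its right side to its left side when its velocity \<open>v\<close> at the crossing
  satisfies \<open>Im (cnj \<sigma>' * v) > 0\<close>, and from left to right when this quantity is negative;
  it cannot vanish for the two perpendicular lifts.\<close>

definition cooriented_perpendicular :: "real \<times> real \<Rightarrow> real \<times> real \<Rightarrow> real \<Rightarrow> bool" where
  "cooriented_perpendicular A B ell \<longleftrightarrow> 0 < ell \<and>
     (\<exists>\<gamma> \<delta> \<sigma> s t. geodesic_with_ends A \<gamma> \<and> geodesic_with_ends B \<delta> \<and>
        range \<gamma> \<inter> range \<delta> = {} \<and>
        hyp_geodesic \<sigma> \<and> \<sigma> 0 = \<gamma> s \<and> \<sigma> ell = \<delta> t \<and>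
        orthogonal (velocity \<sigma> 0) (velocity \<gamma> s) \<and>
        orthogonal (velocity \<sigma> ell) (velocity \<delta> t) \<and>
        (Im (cnj (velocity \<sigma> 0) * velocity \<gamma> s) > 0 \<longleftrightarrow>
         Im (cnj (velocity \<sigma> ell) * velocity \<delta> t) > 0))"

section \<open>Modular geodesics, their intersections and ortho-geodesics\<close>

definition form_ends :: "int bqf \<Rightarrow> real \<times> real" where
  "form_ends Q =
     ((- of_int (coeff_xy Q) - sqrt (of_int (disc Q))) / (2 * of_int (coeff_xx Q)),
      (- of_int (coeff_xy Q) + sqrt (of_int (disc Q))) / (2 * of_int (coeff_xx Q)))"

text \<open>Action of \<open>SL\<^sub>2(\<int>)\<close> on endpoints. It is only used on roots of forms of non-square
  discriminant; these are irrational, so the denominators do not vanish.\<close>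

definition boundary_act :: "int^2^2 \<Rightarrow> real \<Rightarrow> real" where
  "boundary_act g = moebius (of_int (g$1$1)) (of_int (g$1$2)) (of_int (g$2$1)) (of_int (g$2$2))"

definition geodesic_act :: "int^2^2 \<Rightarrow> real \<times> real \<Rightarrow> real \<times> real" where
  "geodesic_act g A = (boundary_act g (fst A), boundary_act g (snd A))"

text \<open>The oriented lifts to the half-plane of the modular geodesic of \<open>Q\<close>.\<close>

definition lifts :: "int bqf \<Rightarrow> (real \<times> real) set" where
  "lifts Q = {geodesic_act g (form_ends Q) | g. det g = 1}"

definition diagonal_orbit ::
    "(real \<times> real) \<times> (real \<times> real) \<Rightarrow> ((real \<times> real) \<times> (real \<times> real)) set" where
  "diagonal_orbit P = {(geodesic_act g (fst P), geodesic_act g (snd P)) | g. det g = 1}"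

definition intersection_points ::
    "int bqf \<Rightarrow> int bqf \<Rightarrow> ((real \<times> real) \<times> (real \<times> real)) set set" where
  "intersection_points Qa Qb =
     {diagonal_orbit (A, B) | A B. A \<in> lifts Qa \<and> B \<in> lifts Qb \<and> (\<exists>\<theta>. crossing_angle A B \<theta>)}"

definition has_angle :: "((real \<times> real) \<times> (real \<times> real)) set \<Rightarrow> real \<Rightarrow> bool" where
  "has_angle I \<theta> \<longleftrightarrow> (\<exists>(A, B) \<in> I. crossing_angle A B \<theta>)"

definition cooriented_orthogeodesics ::
    "int bqf \<Rightarrow> int bqf \<Rightarrow> ((real \<times> real) \<times> (real \<times> real)) set set" where
  "cooriented_orthogeodesics Qa Qb =
     {diagonal_orbit (A, B) | A B.
        A \<in> lifts Qa \<and> B \<in> lifts Qb \<and> (\<exists>ell. cooriented_perpendicular A B ell)}"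

definition has_length :: "((real \<times> real) \<times> (real \<times> real)) set \<Rightarrow> real \<Rightarrow> bool" where
  "has_length J ell \<longleftrightarrow> (\<exists>(A, B) \<in> J. cooriented_perpendicular A B ell)"

section \<open>Comparing a real number with an element of a field\<close>

text \<open>\<open>equals_in_field u k\<close>: the real number \<open>u\<close> is a fraction of integers with denominator
  invertible in the field, and its image in the field is \<open>k\<close>; this image does not depend on the
  fraction. In characteristic 0 it says that \<open>u\<close> is rational with image \<open>k\<close>.

  It is used for equations \<open>u = 1 / ((2 x)\<^sup>2 - \<Delta> y\<^sup>2)\<close> with \<open>u > 0\<close>. In characteristic 0
  a solution automatically has nonzero denominator. In odd characteristic not dividing \<open>\<Delta>\<close>, all
  integral forms of discriminant \<open>\<Delta>\<close> are equivalent over the field, but \<open>u\<close> may have image 0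
  for some intersection points and not for others; the convention \<open>1 / 0 = 0\<close> then makes the
  equation solvable for all of them, as the theorem requires.\<close>

definition equals_in_field :: "real \<Rightarrow> 'k::field \<Rightarrow> bool" where
  "equals_in_field u k \<longleftrightarrow>
     (\<exists>a b :: int. (of_int b :: 'k) \<noteq> 0 \<and> u = of_int a / of_int b \<and> k = of_int a / of_int b)"

end

theory Submission
  imports Defs "HOL-Computational_Algebra.Euclidean_Algorithm"
begin

text \<open>
  Let \<open>D\<close> be the common discriminant of two forms \<open>F\<close>, \<open>G\<close>, and let \<open>c\<close> be their polar form,
  normalised so that \<open>c = D\<close> when \<open>F = G\<close>. Everything is governed by the integer \<open>n = (D + c) / 2\<close>,
  because \<open>n / D\<close> is at the same time the geometric quantity of the theorem and the
  obstruction to equivalence over \<open>K\<close>.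

  Geometry. The unit speed geodesic attached to \<open>F\<close> has velocity \<open>- F(z, 1) / sqrt D\<close> at the point \<open>z\<close>
  (\<open>geodesic_with_ends_form\<close>). For two geodesics through \<open>z\<close> this gives
  \<open>cos \<theta> = c / D\<close> (\<open>cos_crossing_angle\<close>). For a common perpendicular, pulling both forms back by
  the matrix that carries the imaginary axis to the perpendicular turns them into
  \<open>u (x\<^sup>2 - y\<^sup>2)\<close> and \<open>v (x\<^sup>2 - e\<^sup>2\<^sup>\<lambda> y\<^sup>2)\<close>, with \<open>u v > 0\<close> exactly when the co-orientations agree,
  and then \<open>cosh \<lambda> = c / D\<close> (\<open>cosh_cooriented_perpendicular\<close>). By the half-angle formulas both
  \<open>cos\<^sup>2 (\<theta>/2)\<close> and \<open>cosh\<^sup>2 (\<lambda>/2)\<close> are equal to \<open>n / D\<close>.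

  Arithmetic. Attach to \<open>F = l x\<^sup>2 + m x y + r y\<^sup>2\<close> the traceless matrix \<open>X\<^sub>F = (-m/2, -r; l, m/2)\<close>,
  whose square is the scalar \<open>D/4\<close>. A change of variables by \<open>M \<in> SL\<^sub>2\<close> conjugates it:
  \<open>X\<^sub>F M = M X\<^sub>G\<close> for the transformed form \<open>G\<close>.
  Since \<open>X\<^sub>F + X\<^sub>G\<close> also intertwines \<open>X\<^sub>G\<close> and \<open>X\<^sub>F\<close>, and has determinant \<open>- n\<close>, the intertwiners are, when
  \<open>n \<noteq> 0\<close> in \<open>K\<close>, the matrices \<open>(u + v X\<^sub>F) (X\<^sub>F + X\<^sub>G)\<close>, of determinant \<open>- n (u\<^sup>2 - D v\<^sup>2 / 4)\<close>. So \<open>F\<close> and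
  \<open>G\<close> are equivalent if and only if \<open>- n\<close> is a norm from \<open>K(sqrt D)\<close>; as \<open>- D\<close> is a norm, this says that
  \<open>n / D\<close> is one (\<open>psl2_equivalent_iff_norm\<close>). If \<open>n = 0\<close> in \<open>K\<close>, then the characteristic is an odd prime
  \<open>p\<close>, since \<open>n > 0\<close> as an integer; the forms have coefficients in the prime field and represent 1 there, so that all of
  them are equivalent to \<open>x\<^sup>2 - (D/4) y\<^sup>2\<close> (\<open>K_equivalent_finite_char\<close>), while \<open>x = y = 0\<close> solves the equation of
  the theorem.

  The criterion thus holds for every single pair of lifts that meets, or has a co-oriented perpendicular,
  and the equivalences follow as soon as such pairs exist. Extremal forms with
  \<open>l > 0 > r\<close> provide lifts with \<open>\<bar>c\<bar> < D\<close> (\<open>ex_crossing_lifts\<close>), and a large horizontal translation provides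
  lifts with \<open>c > D\<close> (\<open>ex_distant_lifts\<close>).
\<close>

section \<open>Forms, their polar form and changes of variables\<close>

text \<open>The symmetric bilinear form whose quadratic form is the discriminant.\<close>

definition polar :: "'a::comm_ring_1 bqf \<Rightarrow> 'a bqf \<Rightarrow> 'a" where
  "polar F G = coeff_xy F * coeff_xy G
     - 2 * coeff_yy F * coeff_xx G - 2 * coeff_xx F * coeff_yy G"

text \<open>The matrix entries \<open>a, b, c, d\<close> are separate arguments so that the same operation serves
  integral, real and abstract coefficients without coercing matrices.\<close>

definition subst_form :: "'a::comm_ring_1 \<Rightarrow> 'a \<Rightarrow> 'a \<Rightarrow> 'a \<Rightarrow> 'a bqf \<Rightarrow> 'a bqf" where
  "subst_form a b c d F = BQF (bqf_eval F a c)
     (2 * coeff_xx F * a * b + coeff_xy F * (a * d + b * c) + 2 * coeff_yy F * c * d)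
     (bqf_eval F b d)"

lemma bqf_eval_subst_form:
  "bqf_eval (subst_form a b c d F) x y = bqf_eval F (a * x + b * y) (c * x + d * y)"
  by (simp add: bqf_eval_def subst_form_def power2_eq_square algebra_simps)

lemma polar_self: "polar F F = disc F"
  by (simp add: polar_def disc_def power2_eq_square algebra_simps)

lemma polar_subst_form:
  "polar (subst_form a b c d F) (subst_form a b c d G) = (a * d - b * c)^2 * polar F G"
  by (simp add: polar_def subst_form_def bqf_eval_def power2_eq_square algebra_simps)

lemma disc_subst_form: "disc (subst_form a b c d F) = (a * d - b * c)^2 * disc F"
  by (simp flip: polar_self add: polar_subst_form)

lemma bqf_eqI_eval:
  assumes "\<And>x y. bqf_eval F x y = bqf_eval G x y"
  shows "F = G"
proof -
  have "coeff_xx F = coeff_xx G" "coeff_yy F = coeff_yy G"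
    using assms[of 1 0] assms[of 0 1] by (simp_all add: bqf_eval_def)
  moreover have "coeff_xy F = coeff_xy G"
    using assms[of 1 1] calculation by (simp add: bqf_eval_def)
  ultimately show ?thesis by (simp add: bqf.expand)
qed

lemma subst_form_comp:
  "subst_form a b c d (subst_form a' b' c' d' F)
     = subst_form (a' * a + b' * c) (a' * b + b' * d) (c' * a + d' * c) (c' * b + d' * d) F"
  by (rule bqf_eqI_eval) (simp add: bqf_eval_subst_form algebra_simps)

lemma subst_form_id: "subst_form 1 0 0 1 F = F"
  by (rule bqf_eqI_eval) (simp add: bqf_eval_subst_form)

lemma psl2_equivalent_iff_subst_form:
  "psl2_equivalent F G \<longleftrightarrow> (\<exists>a b c d. a * d - b * c = 1 \<and> G = subst_form a b c d F)"
proof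
  assume "psl2_equivalent F G"
  then obtain M :: "'a^2^2" where "det M = 1"
    and M: "\<And>x y. bqf_eval G x y = bqf_eval F (M$1$1 * x + M$1$2 * y) (M$2$1 * x + M$2$2 * y)"
    unfolding psl2_equivalent_def by blast
  moreover have "G = subst_form (M$1$1) (M$1$2) (M$2$1) (M$2$2) F"
    by (rule bqf_eqI_eval) (simp add: bqf_eval_subst_form M)
  ultimately show "\<exists>a b c d. a * d - b * c = 1 \<and> G = subst_form a b c d F"
    by (auto simp: det_2)
next
  assume "\<exists>a b c d. a * d - b * c = 1 \<and> G = subst_form a b c d F"
  then obtain a b c d where "a * d - b * c = 1" "G = subst_form a b c d F"
    by blast
  then show "psl2_equivalent F G"
    unfolding psl2_equivalent_def
    by (intro exI[of _ "vector [vector [a, b], vector [c, d]]"])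
       (simp add: det_2 bqf_eval_subst_form)
qed

lemma psl2_equivalent_subst_form:
  "a * d - b * c = 1 \<Longrightarrow> psl2_equivalent F (subst_form a b c d F)"
  by (auto simp: psl2_equivalent_iff_subst_form)

lemma psl2_equivalent_refl: "psl2_equivalent F F"
  using psl2_equivalent_subst_form[of 1 1 0 0 F] by (simp add: subst_form_id)

lemma psl2_equivalent_sym:
  assumes "psl2_equivalent F G"
  shows "psl2_equivalent G F"
proof -
  obtain a b c d where det: "a * d - b * c = 1" and G: "G = subst_form a b c d F"
    using assms by (auto simp: psl2_equivalent_iff_subst_form)
  have "subst_form d (-b) (-c) a G = subst_form (a*d - b*c) 0 0 (a*d - b*c) F"
    unfolding G subst_form_comp by (simp add: algebra_simps)
  also have "\<dots> = F"
    by (simp add: det subst_form_id)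
  finally show ?thesis
    using psl2_equivalent_subst_form[of d a "-b" "-c" G] det by (simp add: algebra_simps)
qed

lemma psl2_equivalent_trans:
  assumes "psl2_equivalent F G" "psl2_equivalent G H"
  shows "psl2_equivalent F H"
proof -
  obtain a b c d where 1: "a * d - b * c = 1" "G = subst_form a b c d F"
    using assms(1) by (auto simp: psl2_equivalent_iff_subst_form)
  obtain a' b' c' d' where 2: "a' * d' - b' * c' = 1" "H = subst_form a' b' c' d' G"
    using assms(2) by (auto simp: psl2_equivalent_iff_subst_form)
  have "(a * a' + b * c') * (c * b' + d * d') - (a * b' + b * d') * (c * a' + d * c')
      = (a * d - b * c) * (a' * d' - b' * c')"
    by (simp add: algebra_simps)
  then show ?thesis
    using psl2_equivalent_subst_form[of "a * a' + b * c'" "c * b' + d * d'"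
        "a * b' + b * d'" "c * a' + d * c'" F] 1 2
    by (simp add: subst_form_comp)
qed

lemma disc_psl2_equivalent: "psl2_equivalent F G \<Longrightarrow> disc G = disc F"
  by (auto simp: psl2_equivalent_iff_subst_form disc_subst_form)

lemma map_bqf_sel [simp]:
  "coeff_xx (map_bqf f Q) = f (coeff_xx Q)"
  "coeff_xy (map_bqf f Q) = f (coeff_xy Q)"
  "coeff_yy (map_bqf f Q) = f (coeff_yy Q)"
  by (cases Q; simp)+

lemma map_bqf_subst_form:
  "map_bqf of_int (subst_form a b c d Q)
     = subst_form (of_int a) (of_int b) (of_int c) (of_int d) (map_bqf of_int Q)"
  by (simp add: subst_form_def bqf_eval_def)

lemma polar_map_bqf: "polar (map_bqf of_int P) (map_bqf of_int Q) = of_int (polar P Q)"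
  by (simp add: polar_def)

lemma disc_map_bqf: "disc (map_bqf of_int Q) = of_int (disc Q)"
  by (simp add: disc_def)

lemma psl2_equivalent_map_bqf:
  assumes "psl2_equivalent P Q"
  shows "psl2_equivalent (map_bqf of_int P :: 'k::comm_ring_1 bqf) (map_bqf of_int Q)"
proof -
  obtain a b c d where det: "a * d - b * c = 1" and Q: "Q = subst_form a b c d P"
    using assms by (auto simp: psl2_equivalent_iff_subst_form)
  have "(of_int a * of_int d - of_int b * of_int c :: 'k) = 1"
    using arg_cong[OF det, of "of_int :: int \<Rightarrow> 'k"] by simp
  then show ?thesis
    unfolding Q map_bqf_subst_form by (rule psl2_equivalent_subst_form)
qed

section \<open>Equivalence over a field\<close>

text \<open>If \<open>M = (a, b; c, d)\<close> carries \<open>F\<close> to \<open>G\<close>, then by the Cayley-Hamilton identity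
  \<open>(X\<^sub>F + X\<^sub>G) M\<^sup>-\<^sup>1 = X\<^sub>F M\<^sup>-\<^sup>1 + M\<^sup>-\<^sup>1 X\<^sub>F\<close> is a combination of \<open>1\<close> and \<open>X\<^sub>F\<close>: the coefficient of \<open>1\<close> is the trace of
  \<open>X\<^sub>F M\<^sup>-\<^sup>1\<close> and that of \<open>X\<^sub>F\<close> is \<open>a + d\<close>. Its determinant \<open>- n\<close> is therefore a norm. The identity below
  is four times this one.\<close>

lemma psl2_equivalent_imp_norm:
  fixes F G :: "'k::field bqf"
  assumes "psl2_equivalent F G"
  obtains U V where "- 2 * (disc F + polar F G) = U^2 - disc F * V^2"
proof -
  obtain a b c d where det: "a * d - b * c = 1" and G: "G = subst_form a b c d F"
    using assms by (auto simp: psl2_equivalent_iff_subst_form)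
  obtain l m r where F: "F = BQF l m r" by (cases F)
  have "- 2 * (disc F + polar F G)
      = (m * (a - d) + 2 * r * c - 2 * l * b)^2 - disc F * (a + d)^2"
    using det unfolding F G
    by (simp add: disc_def polar_def subst_form_def bqf_eval_def) algebra
  then show thesis by (rule that)
qed

text \<open>The matrix \<open>(u + v X\<^sub>F) (X\<^sub>F + X\<^sub>G)\<close> conjugates \<open>X\<^sub>F\<close> to \<open>X\<^sub>G\<close>, and its determinant is made 1 by the
  choice \<open>u = U / n\<close>, \<open>v = 2 V / n\<close>. In the proof the two factors are handled one after the other:
  the first multiplies \<open>F\<close> by a norm, the second takes \<open>F\<close> to a multiple of \<open>G\<close>.\<close>

lemma psl2_equivalent_of_norm:
  fixes F G :: "'k::field bqf"
  assumes disc: "disc F = D" "disc G = D" and two: "(2::'k) \<noteq> 0"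
    and n: "2 * n = D + polar F G" "n \<noteq> 0"
    and norm: "- n = U^2 - D * V^2"
  shows "psl2_equivalent F G"
proof -
  obtain l m r where F: "F = BQF l m r" by (cases F)
  obtain l' m' r' where G: "G = BQF l' m' r'" by (cases G)
  \<comment> \<open>twice \<open>X\<^sub>F + X\<^sub>G\<close>, where \<open>X\<^sub>F = (-m/2, -r; l, m/2)\<close>\<close>
  define A B C where "A = m + m'" and "B = 2 * (r + r')" and "C = 2 * (l + l')"
  have m2: "m * m = D + 4 * l * r" "m' * m' = D + 4 * l' * r'"
    using disc unfolding F G by (auto simp: disc_def power2_eq_square algebra_simps)
  have n4: "4 * n = 2 * D + 2 * m * m' - 4 * r * l' - 4 * l * r'"
    using arg_cong[OF n(1), of "\<lambda>x. 2 * x"] unfolding F G by (simp add: polar_def)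
  have H: "subst_form (- A) (- B) C A F = BQF (-(4 * n) * l') (-(4 * n) * m') (-(4 * n) * r')"
  proof -
    have "bqf_eval F (- A) C = - (4 * n) * l'"
      unfolding n4 unfolding F A_def C_def bqf_eval_def using m2 by simp algebra
    moreover have "bqf_eval F (- B) A = - (4 * n) * r'"
      unfolding n4 unfolding F A_def B_def bqf_eval_def using m2 by simp algebra
    moreover have "2 * l * (- A) * (- B) + m * ((- A) * A + (- B) * C) + 2 * r * C * A = - (4 * n) * m'"
      unfolding n4 unfolding A_def B_def C_def using m2 by algebra
    ultimately show ?thesis by (simp add: subst_form_def F)
  qed
  have norm': "- n = U^2 - V^2 * m * m + 4 * l * r * V^2"
    using norm m2(1) by algebra
  have E: "bqf_eval F ((U - V * m) * x - 2 * V * r * y) (2 * V * l * x + (U + V * m) * y)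
      = - n * bqf_eval F x y" for x y
    unfolding norm' F by (simp add: bqf_eval_def) algebra
  define k where "k = 1 / (2 * n)"
  have k: "2 * n * k = 1" unfolding k_def using two n(2) by simp
  define a b c d where "a = k * (- (U - V * m) * A - 2 * V * r * C)"
    and "b = k * (- (U - V * m) * B - 2 * V * r * A)"
    and "c = k * (- 2 * V * l * A + (U + V * m) * C)"
    and "d = k * (- 2 * V * l * B + (U + V * m) * A)"
  have scale: "bqf_eval F (k * x) (k * y) = k^2 * bqf_eval F x y" for x y
    by (simp add: bqf_eval_def power2_eq_square algebra_simps)
  have G_eq: "G = subst_form a b c d F"
  proof (rule bqf_eqI_eval)
    fix x y
    define X Y where "X = - A * x - B * y" and "Y = C * x + A * y"
    have "a * x + b * y = (U - V * m) * (k * X) - 2 * V * r * (k * Y)"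
      "c * x + d * y = 2 * V * l * (k * X) + (U + V * m) * (k * Y)"
      by (simp_all add: a_def b_def c_def d_def X_def Y_def algebra_simps)
    then have "bqf_eval (subst_form a b c d F) x y = - n * k^2 * bqf_eval F X Y"
      by (simp add: bqf_eval_subst_form E scale)
    also have "bqf_eval F X Y = bqf_eval (subst_form (- A) (- B) C A F) x y"
      by (simp add: bqf_eval_subst_form X_def Y_def)
    also have "\<dots> = - (4 * n) * bqf_eval G x y"
      unfolding H by (simp add: bqf_eval_def G algebra_simps)
    also have "- n * k^2 * (- (4 * n) * bqf_eval G x y) = (2 * n * k)^2 * bqf_eval G x y"
      by (simp add: power2_eq_square)
    finally show "bqf_eval G x y = bqf_eval (subst_form a b c d F) x y"
      by (simp add: k)
  qed
  have "a * d - b * c = k^2 * ((U - V * m) * (U + V * m) + 4 * V^2 * l * r) * (B * C - A * A)"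
    unfolding a_def b_def c_def d_def by algebra
  also have "(U - V * m) * (U + V * m) + 4 * V^2 * l * r = - n"
    unfolding norm' by algebra
  also have "B * C - A * A = - (4 * n)"
    unfolding n4 A_def B_def C_def using m2 by algebra
  also have "k^2 * (- n) * (- (4 * n)) = (2 * n * k)^2"
    by (simp add: power2_eq_square)
  finally have "a * d - b * c = 1" by (simp add: k)
  then show ?thesis
    unfolding G_eq by (rule psl2_equivalent_subst_form)
qed

text \<open>Passing between \<open>- n\<close> and \<open>D / n\<close> uses that \<open>- D = 0\<^sup>2 - D 1\<^sup>2\<close> is a norm: multiplication by it
  exchanges the two coordinates of the norm form up to scaling.\<close>

lemma psl2_equivalent_iff_norm:
  fixes F G :: "'k::field bqf"
  assumes disc: "disc F = D" "disc G = D" and two: "(2::'k) \<noteq> 0"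
    and n: "2 * n = D + polar F G" "n \<noteq> 0" and D: "D \<noteq> 0"
  shows "psl2_equivalent F G \<longleftrightarrow> (\<exists>x y. n / D = 1 / ((2 * x)^2 - D * y^2))"
proof
  assume "psl2_equivalent F G"
  then obtain U V where "- 2 * (disc F + polar F G) = U^2 - disc F * V^2"
    by (rule psl2_equivalent_imp_norm)
  then have UV: "- 4 * n = U^2 - D * V^2"
    using arg_cong[OF n(1), of "\<lambda>x. 2 * x"] disc(1) by simp
  have four: "(4::'k) \<noteq> 0" using two by (metis mult_2 numeral_Bit0 no_zero_divisors)
  define x y where "x = D * V / (4 * n)" and "y = U / (2 * n)"
  have "(2 * x)^2 - D * y^2 = - D * (U^2 - D * V^2) / (4 * n^2)"
    unfolding x_def y_def using two four n(2)
    by (simp add: field_simps power2_eq_square)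
  also have "\<dots> = D / n"
    unfolding UV[symmetric] using four n(2) by (simp add: field_simps power2_eq_square)
  finally have "n / D = 1 / ((2 * x)^2 - D * y^2)" by simp
  then show "\<exists>x y. n / D = 1 / ((2 * x)^2 - D * y^2)" by blast
next
  assume "\<exists>x y. n / D = 1 / ((2 * x)^2 - D * y^2)"
  then obtain x y where xy: "n / D = 1 / ((2 * x)^2 - D * y^2)" by blast
  then have "D = n * ((2 * x)^2 - D * y^2)"
    using n(2) D by (cases "(2 * x)^2 - D * y^2 = 0") (auto simp: divide_eq_eq)
  then have "(D * D) * (- n) = (D * D) * ((n * y)^2 - D * (2 * n * x / D)^2)"
    using D by (simp add: field_simps power2_eq_square) algebra
  moreover have "D * D \<noteq> 0" using D by simp
  ultimately have "- n = (n * y)^2 - D * (2 * n * x / D)^2"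
    by (metis mult_left_cancel)
  then show "psl2_equivalent F G"
    by (rule psl2_equivalent_of_norm[OF disc two n])
qed

section \<open>Forms of equal discriminant in odd characteristic\<close>

text \<open>Pigeonhole: modulo \<open>p\<close>, the values of \<open>X\<^sup>2\<close> and those of \<open>a + D Y\<^sup>2\<close> both number
  \<open>(p + 1) / 2\<close>, so they cannot be disjoint.\<close>

lemma norm_form_universal_mod_prime:
  fixes a D :: int
  assumes "prime p" "p \<noteq> 2" and D: "\<not> int p dvd D"
  shows "\<exists>X Y. int p dvd X^2 - D * Y^2 - a"
proof -
  have p: "prime (int p)" "odd p" "p > 2"
    using assms(1,2) prime_odd_nat prime_ge_2_nat[of p] by (auto simp: le_less)
  define S where "S = {0..int p div 2}"
  have inj: "x = y" if "x \<in> S" "y \<in> S" "int p dvd x^2 - y^2" for x y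
  proof -
    have "int p dvd (x - y) * (x + y)"
      using that(3) by (simp add: power2_eq_square algebra_simps)
    then consider "int p dvd x - y" | "int p dvd x + y"
      using p(1) prime_dvd_multD by blast
    then show ?thesis
    proof cases
      case 1
      have "\<bar>x - y\<bar> < int p" using that p by (auto simp: S_def)
      then show ?thesis using 1 zdvd_imp_le[of "int p" "\<bar>x - y\<bar>"] by fastforce
    next
      case 2
      have "x + y < int p" "0 \<le> x + y" using that p by (auto simp: S_def elim!: oddE)
      then have "x + y = 0" using 2 zdvd_imp_le[of "int p" "x + y"] by fastforce
      then show ?thesis using that by (auto simp: S_def)
    qed
  qed
  define f g where "f x = x^2 mod int p" and "g y = (a + D * y^2) mod int p" for x y
  have injf: "inj_on f S"
    by (rule inj_onI) (auto simp: f_def mod_eq_dvd_iff intro: inj)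
  have injg: "inj_on g S"
  proof (rule inj_onI)
    fix x y assume xy: "x \<in> S" "y \<in> S" "g x = g y"
    then have "int p dvd D * (x^2 - y^2)"
      by (simp add: g_def mod_eq_dvd_iff algebra_simps)
    then have "int p dvd x^2 - y^2"
      using D p(1) prime_dvd_multD by blast
    then show "x = y" using inj xy by blast
  qed
  have "f ` S \<inter> g ` S \<noteq> {}"
  proof
    assume disj: "f ` S \<inter> g ` S = {}"
    have fin: "finite S" by (simp add: S_def)
    have "card (f ` S \<union> g ` S) = card S + card S"
      using disj fin by (simp add: card_Un_disjoint card_image injf injg)
    moreover have "f ` S \<union> g ` S \<subseteq> {0..<int p}"
      using p by (auto simp: f_def g_def)
    then have "card (f ` S \<union> g ` S) \<le> p"
      using card_mono[of "{0..<int p}" "f ` S \<union> g ` S"] by simp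
    moreover have "card S + card S = p + 1"
      using p by (auto simp: S_def elim!: oddE)
    ultimately show False by simp
  qed
  then obtain X Y where "f X = g Y" by auto
  then have "int p dvd X^2 - D * Y^2 - a"
    by (simp add: f_def g_def mod_eq_dvd_iff algebra_simps)
  then show ?thesis by blast
qed

text \<open>Complete \<open>(x, y)\<close> to a basis of determinant 1, so that the leading coefficient becomes 1, then
  complete the square.\<close>

lemma principal_form_of_represents_1:
  fixes F :: "'k::field bqf"
  assumes one: "bqf_eval F x y = 1" and two: "(2::'k) \<noteq> 0"
  shows "psl2_equivalent F (BQF 1 0 (- disc F / 4))"
proof -
  have "\<exists>b d. x * d - b * y = 1"
  proof (cases "x = 0")
    case True
    then have "y \<noteq> 0" using one by (auto simp: bqf_eval_def)
    then have "x * 0 - (- 1 / y) * y = 1" by simp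
    then show ?thesis by blast
  next
    case False
    then have "x * (1 / x) - 0 * y = 1" by simp
    then show ?thesis by blast
  qed
  then obtain b d where det: "x * d - b * y = 1" by blast
  define G where "G = subst_form x b y d F"
  have FG: "psl2_equivalent F G"
    unfolding G_def using det by (rule psl2_equivalent_subst_form)
  have xx: "coeff_xx G = 1" by (simp add: G_def subst_form_def one)
  define H where "H = subst_form 1 (- coeff_xy G / 2) 0 1 G"
  have GH: "psl2_equivalent G H"
    unfolding H_def by (rule psl2_equivalent_subst_form) simp
  have H: "coeff_xx H = 1" "coeff_xy H = 0"
    using two by (simp_all add: H_def subst_form_def bqf_eval_def xx)
  have four: "(4::'k) \<noteq> 0" using two by (metis mult_2 numeral_Bit0 no_zero_divisors)
  have "disc H = disc F"
    using disc_psl2_equivalent[OF FG] disc_psl2_equivalent[OF GH] by simp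
  then have "coeff_yy H = - disc F / 4"
    using H four by (simp add: disc_def field_simps)
  with H have "H = BQF 1 0 (- disc F / 4)" by (simp add: bqf.expand)
  with FG GH show ?thesis using psl2_equivalent_trans by blast
qed

lemma two_neq_0_if_CHAR:
  assumes "CHAR('k::field) \<noteq> 2"
  shows "(2::'k) \<noteq> 0"
proof
  assume "(2::'k) = 0"
  then have "CHAR('k) dvd 2" using of_nat_eq_0_iff_char_dvd[of 2, where 'a = 'k] by simp
  then have "CHAR('k) \<noteq> 0" "CHAR('k) \<le> 2"
    by (metis dvd_0_left_iff zero_neq_numeral) (use \<open>CHAR('k) dvd 2\<close> in \<open>simp add: dvd_imp_le\<close>)
  moreover have "CHAR('k) \<noteq> 1" by simp
  ultimately show False using assms by linarith
qed

text \<open>From \<open>4 l Q(x, y) = (2 l x + m y)\<^sup>2 - D y\<^sup>2\<close>: when \<open>l\<close> is invertible it suffices that the norm form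
  takes the value \<open>4 l\<close>, and when \<open>l = 0\<close> the form is linear in \<open>x\<close> on the line \<open>y = 1\<close>.\<close>

lemma represents_1_finite_char:
  fixes Q :: "int bqf"
  assumes char: "CHAR('k::field) > 0" "CHAR('k) \<noteq> 2" and D: "(of_int (disc Q) :: 'k) \<noteq> 0"
  shows "\<exists>x y. bqf_eval (map_bqf of_int Q :: 'k bqf) x y = 1"
proof -
  define p where "p = CHAR('k)"
  have p: "prime p" "p \<noteq> 2"
    using char prime_CHAR_semidom[where 'a = 'k] by (auto simp: p_def)
  obtain l m r where Q: "Q = BQF l m r" by (cases Q)
  define l' m' r' where "l' = (of_int l :: 'k)" and "m' = (of_int m :: 'k)" and "r' = (of_int r :: 'k)"
  have two: "(2::'k) \<noteq> 0" using char(2) by (rule two_neq_0_if_CHAR)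
  show ?thesis
  proof (cases "l' = 0")
    case True
    then have "m' \<noteq> 0" using D by (auto simp: Q disc_def l'_def m'_def)
    then have "bqf_eval (map_bqf of_int Q :: 'k bqf) ((1 - r') / m') 1 = 1"
      using True by (simp add: bqf_eval_def Q flip: l'_def m'_def r'_def)
    then show ?thesis by blast
  next
    case False
    have "\<not> int p dvd disc Q"
      using D of_int_eq_0_iff_char_dvd[of "disc Q", where 'a = 'k] by (simp add: p_def)
    from norm_form_universal_mod_prime[OF p this, of "4 * l"]
    obtain X Y where "int p dvd X^2 - disc Q * Y^2 - 4 * l" by blast
    then have "(of_int (X^2 - disc Q * Y^2 - 4 * l) :: 'k) = 0"
      unfolding of_int_eq_0_iff_char_dvd p_def .
    then have XY: "(of_int X)^2 - (m'^2 - 4 * l' * r') * (of_int Y)^2 - 4 * l' = 0"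
      by (simp add: Q disc_def l'_def m'_def r'_def)
    define x where "x = (of_int X - m' * of_int Y) / (2 * l')"
    have "of_int X = 2 * l' * x + m' * of_int Y"
      using False two by (simp add: x_def)
    from XY[unfolded this] have "4 * l' * (l' * x^2 + m' * x * of_int Y + r' * (of_int Y)^2 - 1) = 0"
      by algebra
    moreover have "(4::'k) \<noteq> 0" using two by (metis mult_2 numeral_Bit0 no_zero_divisors)
    ultimately have "l' * x^2 + m' * x * of_int Y + r' * (of_int Y)^2 = 1"
      using False by simp
    then show ?thesis
      by (intro exI[of _ x] exI[of _ "of_int Y"]) (simp add: bqf_eval_def Q l'_def m'_def r'_def)
  qed
qed

lemma K_equivalent_finite_char:
  assumes char: "CHAR('k::field) > 0" "CHAR('k) \<noteq> 2"
    and disc: "disc Qa = \<Delta>" "disc Qb = \<Delta>" and D: "(of_int \<Delta> :: 'k) \<noteq> 0"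
  shows "K_equivalent TYPE('k) Qa Qb"
proof -
  have *: "psl2_equivalent (map_bqf of_int Q) (BQF (1::'k) 0 (- of_int \<Delta> / 4))" if Q: "disc Q = \<Delta>" for Q
  proof -
    obtain x y where "bqf_eval (map_bqf of_int Q :: 'k bqf) x y = 1"
      using represents_1_finite_char[OF char] D Q by blast
    from principal_form_of_represents_1[OF this two_neq_0_if_CHAR[OF char(2)]] show ?thesis
      by (simp add: disc_map_bqf Q)
  qed
  show ?thesis
    unfolding K_equivalent_def
    using *[OF disc(1)] *[OF disc(2)] psl2_equivalent_sym psl2_equivalent_trans by blast
qed

section \<open>Parametrised geodesics with real ends\<close>

definition geodesic_map :: "real \<Rightarrow> real \<Rightarrow> real \<Rightarrow> real \<Rightarrow> real \<Rightarrow> complex" where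
  "geodesic_map a b c d t = moebius (of_real a) (of_real b) (of_real c) (of_real d) (\<i> * of_real (exp t))"

lemma hyp_geodesic_iff:
  "hyp_geodesic \<gamma> \<longleftrightarrow> (\<exists>a b c d. a * d - b * c = 1 \<and> \<gamma> = geodesic_map a b c d)"
proof
  assume "hyp_geodesic \<gamma>"
  then show "\<exists>a b c d. a * d - b * c = 1 \<and> \<gamma> = geodesic_map a b c d"
    unfolding hyp_geodesic_def geodesic_map_def[abs_def] det_2 by blast
next
  assume "\<exists>a b c d. a * d - b * c = 1 \<and> \<gamma> = geodesic_map a b c d"
  then obtain a b c d where "a * d - b * c = 1" "\<gamma> = geodesic_map a b c d" by blast
  then show "hyp_geodesic \<gamma>"
    unfolding hyp_geodesic_def
    by (intro exI[of _ "vector [vector [a, b], vector [c, d]]"])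
       (simp add: det_2 geodesic_map_def[abs_def])
qed

lemma geodesic_denominator_nonzero:
  assumes "a * d - b * c = (1::real)"
  shows "of_real c * (\<i> * of_real (exp t)) + of_real d \<noteq> (0::complex)"
  using assms by (auto simp: complex_eq_iff)

lemma Im_geodesic_map:
  assumes "a * d - b * c = 1"
  shows "Im (geodesic_map a b c d t) = exp t / ((c * exp t)^2 + d^2)"
proof -
  have "a * exp t * d - b * (c * exp t) = exp t * (a * d - b * c)" by (simp add: algebra_simps)
  then show ?thesis
    by (simp add: geodesic_map_def moebius_def Im_divide assms power2_eq_square algebra_simps)
qed

lemma Im_geodesic_map_pos:
  assumes "a * d - b * c = 1"
  shows "Im (geodesic_map a b c d t) > 0"
proof -
  have "(c * exp t)^2 + d^2 > 0"
    using assms by (auto simp: sum_power2_gt_zero_iff)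
  then show ?thesis unfolding Im_geodesic_map[OF assms] by simp
qed

lemma has_vector_derivative_geodesic_map:
  assumes "a * d - b * c = 1"
  shows "(geodesic_map a b c d has_vector_derivative
    \<i> * of_real (exp t) / (of_real c * (\<i> * of_real (exp t)) + of_real d)^2) (at t)"
proof -
  define f where "f w = (of_real a * (\<i> * exp w) + of_real b) / (of_real c * (\<i> * exp w) + of_real d)" for w
  have nz: "of_real c * (\<i> * exp (of_real t)) + of_real d \<noteq> (0::complex)"
    using geodesic_denominator_nonzero[OF assms, of t] by (simp add: exp_of_real)
  have "of_real (a * d - b * c) = (1::complex)" using assms by simp
  then have det: "of_real a * of_real d = 1 + of_real b * (of_real c::complex)"
    by (simp add: algebra_simps)
  have num: "w * \<i> * of_real a * (of_real c * (\<i> * w) + of_real d)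
      - (of_real a * (\<i> * w) + of_real b) * (w * \<i> * of_real c) = \<i> * w" for w :: complex
    using det by algebra
  have "(f has_field_derivative (\<i> * exp (of_real t) / (of_real c * (\<i> * exp (of_real t)) + of_real d)^2))
     (at (of_real t))"
    unfolding f_def[abs_def]
    by (rule derivative_eq_intros refl nz)+
       (use num[of "exp (of_real t)"] in \<open>simp add: power2_eq_square\<close>)
  from has_vector_derivative_real_field[OF this]
  have "((\<lambda>t. f (of_real t)) has_vector_derivative (\<i> * exp (of_real t) / (of_real c * (\<i> * exp (of_real t)) + of_real d)^2)) (at t)"
    by simp
  moreover have "(\<lambda>t. f (of_real t)) = geodesic_map a b c d"
    by (simp add: f_def geodesic_map_def moebius_def exp_of_real fun_eq_iff)
  ultimately show ?thesis
    by (simp add: exp_of_real)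
qed

lemma velocity_geodesic_map:
  assumes "a * d - b * c = 1"
  shows "velocity (geodesic_map a b c d) t
    = \<i> * of_real (exp t) / (of_real c * (\<i> * of_real (exp t)) + of_real d)^2"
  unfolding velocity_def
  by (rule vector_derivative_at[OF has_vector_derivative_geodesic_map[OF assms]])

lemma geodesic_map_limits:
  assumes "c \<noteq> 0" "d \<noteq> 0"
  shows "(geodesic_map a b c d \<longlongrightarrow> of_real (b / d)) at_bot"
    and "(geodesic_map a b c d \<longlongrightarrow> of_real (a / c)) at_top"
proof -
  have 0: "((\<lambda>t. of_real (exp t) :: complex) \<longlongrightarrow> 0) at_bot"
    using tendsto_of_real[OF exp_at_bot, where 'a = complex] by simp
  have "((\<lambda>t. (of_real a * (\<i> * of_real (exp t)) + of_real b) / (of_real c * (\<i> * of_real (exp t)) + of_real d))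
     \<longlongrightarrow> (of_real a * (\<i> * 0) + of_real b) / (of_real c * (\<i> * 0) + of_real d :: complex)) at_bot"
    using assms by (intro tendsto_intros 0) simp
  then show "(geodesic_map a b c d \<longlongrightarrow> of_real (b / d)) at_bot"
    by (simp add: geodesic_map_def[abs_def] moebius_def)
  have "((\<lambda>t::real. exp (- t)) \<longlongrightarrow> 0) at_top"
    by (rule filterlim_compose[OF exp_at_bot filterlim_uminus_at_bot_at_top])
  then have 1: "((\<lambda>t. of_real (exp (- t)) :: complex) \<longlongrightarrow> 0) at_top"
    using tendsto_of_real by fastforce
  have "((\<lambda>t. (of_real a * \<i> + of_real b * of_real (exp (- t))) / (of_real c * \<i> + of_real d * of_real (exp (- t))))
     \<longlongrightarrow> (of_real a * \<i> + of_real b * 0) / (of_real c * \<i> + of_real d * 0 :: complex)) at_top"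
    using assms by (intro tendsto_intros 1) simp
  also have "(\<lambda>t. (of_real a * \<i> + of_real b * of_real (exp (- t))) / (of_real c * \<i> + of_real d * of_real (exp (- t))))
     = geodesic_map a b c d"
  proof
    fix t
    have "geodesic_map a b c d t = (of_real (exp (- t)) * (of_real a * (\<i> * of_real (exp t)) + of_real b))
       / (of_real (exp (- t)) * (of_real c * (\<i> * of_real (exp t)) + of_real d))"
      by (simp add: geodesic_map_def moebius_def)
    moreover have "of_real (exp (- t)) * (x * (\<i> * of_real (exp t)) + y) = x * \<i> + y * of_real (exp (- t))"
      for x y :: complex
      by (simp add: exp_minus field_simps flip: of_real_mult)
    ultimately show "(of_real a * \<i> + of_real b * of_real (exp (- t))) / (of_real c * \<i> + of_real d * of_real (exp (- t)))
      = geodesic_map a b c d t" by simp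
  qed
  finally show "(geodesic_map a b c d \<longlongrightarrow> of_real (a / c)) at_top"
    by simp
qed

text \<open>An end at infinity would make the height behave like \<open>e\<^sup>t\<close> or \<open>e\<^sup>-\<^sup>t\<close>, up to a constant, whereas
  convergence to a real number forces it to tend to 0.\<close>

lemma geodesic_map_infinite_end:
  assumes det: "a * d - b * c = 1"
  shows "(geodesic_map a b c d \<longlongrightarrow> of_real q) at_top \<Longrightarrow> c \<noteq> 0"
    and "(geodesic_map a b c d \<longlongrightarrow> of_real p) at_bot \<Longrightarrow> d \<noteq> 0"
proof -
  assume lim: "(geodesic_map a b c d \<longlongrightarrow> of_real q) at_top"
  show "c \<noteq> 0"
  proof
    assume c: "c = 0"
    then have d: "d \<noteq> 0" using det by auto
    have "((\<lambda>t. Im (geodesic_map a b c d t)) \<longlongrightarrow> 0) at_top"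
      using tendsto_Im[OF lim] by simp
    then have "((\<lambda>t. d^2 * Im (geodesic_map a b c d t)) \<longlongrightarrow> d^2 * 0) at_top"
      by (intro tendsto_intros)
    moreover have "d^2 * Im (geodesic_map a b c d t) = exp t" for t
      unfolding Im_geodesic_map[OF det] using c d by simp
    ultimately have "(exp \<longlongrightarrow> (0::real)) at_top" by simp
    then show False
      using not_tendsto_and_filterlim_at_infinity[of at_top "exp :: real \<Rightarrow> real" 0]
        filterlim_at_top_imp_at_infinity[OF exp_at_top] by simp
  qed
next
  assume lim: "(geodesic_map a b c d \<longlongrightarrow> of_real p) at_bot"
  show "d \<noteq> 0"
  proof
    assume d: "d = 0"
    then have c: "c \<noteq> 0" using det by auto
    have "((\<lambda>t. Im (geodesic_map a b c d t)) \<longlongrightarrow> 0) at_bot"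
      using tendsto_Im[OF lim] by simp
    then have "((\<lambda>t. c^2 * Im (geodesic_map a b c d t)) \<longlongrightarrow> c^2 * 0) at_bot"
      by (intro tendsto_intros)
    moreover have "c^2 * Im (geodesic_map a b c d t) = exp (- t)" for t
      unfolding Im_geodesic_map[OF det] using c d by (simp add: exp_minus power2_eq_square field_simps)
    ultimately have "((\<lambda>t::real. exp (- t)) \<longlongrightarrow> 0) at_bot" by simp
    moreover have "filterlim (\<lambda>t::real. exp (- t)) at_top at_bot"
      by (rule filterlim_compose[OF exp_at_top filterlim_uminus_at_top_at_bot])
    ultimately show False
      using not_tendsto_and_filterlim_at_infinity[of at_bot "\<lambda>t::real. exp (- t)" 0]
        filterlim_at_top_imp_at_infinity by auto
  qed
qed

text \<open>Real ends determine the matrix up to the scaling \<open>(c, d) \<mapsto> (k c, d / k)\<close>, which is the choice of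
  the origin of time.\<close>

lemma geodesic_with_endsE:
  assumes "geodesic_with_ends (p, q) \<gamma>"
  obtains c d where "c * d * (q - p) = 1" "\<gamma> = geodesic_map (q * c) (p * d) c d"
proof -
  obtain a b c d where det: "a * d - b * c = 1" and \<gamma>: "\<gamma> = geodesic_map a b c d"
    and lim: "(\<gamma> \<longlongrightarrow> of_real p) at_bot" "(\<gamma> \<longlongrightarrow> of_real q) at_top"
    using assms by (auto simp: geodesic_with_ends_def hyp_geodesic_iff)
  have c: "c \<noteq> 0" and d: "d \<noteq> 0"
    using geodesic_map_infinite_end[OF det] lim unfolding \<gamma> by blast+
  have "complex_of_real p = of_real (b / d)"
    using lim(1) geodesic_map_limits(1)[OF c d] tendsto_unique[OF trivial_limit_at_bot_linorder] unfolding \<gamma> by blast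
  then have p: "b = p * d" using d by (auto simp: of_real_eq_iff simp del: of_real_divide)
  have "complex_of_real q = of_real (a / c)"
    using lim(2) geodesic_map_limits(2)[OF c d] tendsto_unique[OF trivial_limit_at_top_linorder] unfolding \<gamma> by blast
  then have q: "a = q * c" using c by (auto simp: of_real_eq_iff simp del: of_real_divide)
  show thesis
    using that[of c d] det by (simp add: \<gamma> p q algebra_simps)
qed

lemma geodesic_with_endsI:
  assumes "c * d * (q - p) = 1"
  shows "geodesic_with_ends (p, q) (geodesic_map (q * c) (p * d) c d)"
proof -
  have "c \<noteq> 0" "d \<noteq> 0" using assms by auto
  moreover have "hyp_geodesic (geodesic_map (q * c) (p * d) c d)"
    unfolding hyp_geodesic_iff using assms
    by (intro exI[of _ "q * c"] exI[of _ "p * d"] exI[of _ c] exI[of _ d]) (simp add: algebra_simps)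
  ultimately show ?thesis
    using geodesic_map_limits[of c d "q * c" "p * d"] by (simp add: geodesic_with_ends_def)
qed

section \<open>The geodesic of a real form and crossing angles\<close>

definition form_at :: "real bqf \<Rightarrow> complex \<Rightarrow> complex" where
  "form_at F z = of_real (coeff_xx F) * z^2 + of_real (coeff_xy F) * z + of_real (coeff_yy F)"

text \<open>The semicircle spanned by the roots of \<open>F\<close>: the zero set in the upper half-plane of the Hermitian form
  attached to \<open>F\<close>.\<close>

definition on_geodesic :: "real bqf \<Rightarrow> complex \<Rightarrow> bool" where
  "on_geodesic F z \<longleftrightarrow> Im z > 0 \<and>
     coeff_xx F * ((Re z)^2 + (Im z)^2) + coeff_xy F * Re z + coeff_yy F = 0"

text \<open>The same formula as \<open>form_ends\<close>, for real forms: besides the integral ones, the form of the common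
  perpendicular of two geodesics is needed.\<close>

definition ends :: "real bqf \<Rightarrow> real \<times> real" where
  "ends F = ((- coeff_xy F - sqrt (disc F)) / (2 * coeff_xx F),
             (- coeff_xy F + sqrt (disc F)) / (2 * coeff_xx F))"

lemma ends_coeffs:
  assumes "ends F = (p, q)" and l: "coeff_xx F \<noteq> 0" and D: "disc F > 0"
  shows "coeff_xx F * (q - p) = sqrt (disc F)" "coeff_xx F * (p + q) = - coeff_xy F"
    "coeff_xx F * p * q = coeff_yy F"
proof -
  have p: "2 * coeff_xx F * p = - coeff_xy F - sqrt (disc F)"
    and q: "2 * coeff_xx F * q = - coeff_xy F + sqrt (disc F)"
    using assms by (auto simp: ends_def)
  show "coeff_xx F * (q - p) = sqrt (disc F)" "coeff_xx F * (p + q) = - coeff_xy F"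
    using p q by (simp_all add: algebra_simps)
  have "(2 * coeff_xx F * p) * (2 * coeff_xx F * q) = (coeff_xy F)^2 - (sqrt (disc F))^2"
    unfolding p q by (simp add: power2_eq_square algebra_simps)
  also have "\<dots> = 4 * coeff_xx F * coeff_yy F"
    using D by (simp add: disc_def)
  finally have "4 * coeff_xx F * (coeff_xx F * p * q) = 4 * coeff_xx F * coeff_yy F"
    by (simp add: algebra_simps)
  then show "coeff_xx F * p * q = coeff_yy F" using l by simp
qed

lemma form_at_factor:
  assumes "ends F = (p, q)" "coeff_xx F \<noteq> 0" "disc F > 0"
  shows "form_at F z = of_real (coeff_xx F) * (z - of_real p) * (z - of_real q)"
proof -
  note c = ends_coeffs[OF assms]
  have m: "coeff_xy F = - coeff_xx F * (p + q)" using c by simp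
  show ?thesis
    unfolding form_at_def m c(3)[symmetric] by (simp add: power2_eq_square algebra_simps)
qed

lemma on_geodesic_iff_ends:
  assumes "ends F = (p, q)" "coeff_xx F \<noteq> 0" "disc F > 0"
  shows "on_geodesic F z \<longleftrightarrow> Im z > 0 \<and> (Re z)^2 + (Im z)^2 - (p + q) * Re z + p * q = 0"
proof -
  note c = ends_coeffs[OF assms]
  have "coeff_xx F * ((Re z)^2 + (Im z)^2) + coeff_xy F * Re z + coeff_yy F
      = coeff_xx F * ((Re z)^2 + (Im z)^2 - (p + q) * Re z + p * q)"
    unfolding c(3)[symmetric] using c(2) by algebra
  then show ?thesis using assms(2) by (simp add: on_geodesic_def)
qed

text \<open>With ends \<open>p, q\<close> and \<open>w = c i e\<^sup>t + d\<close>, one has \<open>z - p = i e\<^sup>t c (q - p) / w\<close> and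
  \<open>z - q = - d (q - p) / w\<close>, where \<open>c d (q - p) = 1\<close>. Their product \<open>- (q - p) i e\<^sup>t / w\<^sup>2\<close> is \<open>- (q - p)\<close> times
  the velocity, and the product of the first with the conjugate of the second is purely imaginary,
  which is the equation of the semicircle.\<close>

lemma geodesic_with_ends_form:
  assumes \<gamma>: "geodesic_with_ends (ends F) \<gamma>" and F: "coeff_xx F \<noteq> 0" "disc F > 0"
  shows "on_geodesic F (\<gamma> t)"
    and "velocity \<gamma> t = - form_at F (\<gamma> t) / of_real (sqrt (disc F))"
proof -
  obtain p q where pq: "ends F = (p, q)" by fastforce
  obtain c d where cd: "c * d * (q - p) = 1" and \<gamma>': "\<gamma> = geodesic_map (q * c) (p * d) c d"
    using \<gamma> unfolding pq by (rule geodesic_with_endsE)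
  have det: "q * c * d - p * d * c = 1" using cd by (simp add: algebra_simps)
  have nz: "c \<noteq> 0" "d \<noteq> 0" using cd by auto
  define w where "w = of_real c * (\<i> * of_real (exp t)) + (of_real d :: complex)"
  have w: "w \<noteq> 0" unfolding w_def using det by (rule geodesic_denominator_nonzero)
  have z: "\<gamma> t = (of_real (q * c) * (\<i> * of_real (exp t)) + of_real (p * d)) / w"
    by (simp add: \<gamma>' geodesic_map_def moebius_def w_def)
  have cd': "of_real c * of_real d * (of_real q - of_real p) = (1::complex)"
    using cd by (metis of_real_1 of_real_diff of_real_mult)
  have zp: "\<gamma> t - of_real p = \<i> * of_real (exp t) * of_real c * (of_real q - of_real p) / w"
    using w by (simp add: z divide_simps) (simp add: w_def algebra_simps)
  have zq: "\<gamma> t - of_real q = - of_real d * (of_real q - of_real p) / w"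
    using w by (simp add: z divide_simps) (simp add: w_def algebra_simps)
  have "form_at F (\<gamma> t) = - of_real (coeff_xx F * (q - p)) * (\<i> * of_real (exp t) / w^2)
      * (of_real c * of_real d * (of_real q - of_real p))"
    unfolding form_at_factor[OF pq F] zp zq by (simp add: power2_eq_square)
  then have "form_at F (\<gamma> t) = - of_real (sqrt (disc F)) * (\<i> * of_real (exp t) / w^2)"
    unfolding cd' ends_coeffs(1)[OF pq F] by simp
  moreover have "velocity \<gamma> t = \<i> * of_real (exp t) / w^2"
    unfolding \<gamma>' w_def using det by (rule velocity_geodesic_map)
  ultimately show "velocity \<gamma> t = - form_at F (\<gamma> t) / of_real (sqrt (disc F))"
    using F(2) by simp
  have "(\<gamma> t - of_real p) * cnj (\<gamma> t - of_real q)
      = - \<i> * of_real (exp t) * of_real (c * d * (q - p)^2) / (w * cnj w)"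
    unfolding zp zq by (simp add: power2_eq_square)
  also have "\<dots> = \<i> * of_real (- exp t * (c * d * (q - p)^2) / (cmod w)^2)"
    by (simp add: complex_mult_cnj cmod_power2)
  finally have "Re ((\<gamma> t - of_real p) * cnj (\<gamma> t - of_real q)) = 0" by simp
  moreover have "Im (\<gamma> t) > 0"
    unfolding \<gamma>' using det by (rule Im_geodesic_map_pos)
  ultimately show "on_geodesic F (\<gamma> t)"
    unfolding on_geodesic_iff_ends[OF pq F] by (simp add: power2_eq_square algebra_simps)
qed

text \<open>A point \<open>z\<close> of the semicircle is reached at the time \<open>t\<close> with \<open>i e\<^sup>t (q - p) = (z - p) / (q - z)\<close>; the
  right-hand side is purely imaginary because the semicircle sees its diameter under a right angle.\<close>

lemma ex_geodesic_with_ends_form: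
  assumes F: "coeff_xx F \<noteq> 0" "disc F > 0"
  obtains \<gamma> where "geodesic_with_ends (ends F) \<gamma>" "\<And>z. on_geodesic F z \<Longrightarrow> \<exists>t. \<gamma> t = z"
proof -
  obtain p q where pq: "ends F = (p, q)" by fastforce
  have "q - p \<noteq> 0" using ends_coeffs(1)[OF pq F] F(2) by auto
  define d where "d = 1 / (q - p)"
  have d: "1 * d * (q - p) = 1" "d \<noteq> 0" using \<open>q - p \<noteq> 0\<close> by (simp_all add: d_def)
  have "\<exists>t. geodesic_map (q * 1) (p * d) 1 d t = z" if z: "on_geodesic F z" for z
  proof -
    have y: "Im z > 0" and circ: "(Re z)^2 + (Im z)^2 - (p + q) * Re z + p * q = 0"
      using z unfolding on_geodesic_iff_ends[OF pq F] by auto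
    define N where "N = (q - Re z)^2 + (Im z)^2"
    have N: "N > 0" using y by (simp add: N_def add_nonneg_pos)
    define t where "t = ln (Im z / N)"
    have E: "exp t = Im z / N" using y N by (simp add: t_def)
    have "of_real d * (z - of_real p) = \<i> * of_real (exp t) * (of_real q - z)"
    proof (rule complex_eqI)
      have "N * (Re z - p) = (q - p) * (Im z * Im z)"
        unfolding N_def using circ by algebra
      then show "Re (of_real d * (z - of_real p)) = Re (\<i> * of_real (exp t) * (of_real q - z))"
        using N \<open>q - p \<noteq> 0\<close> by (simp add: E d_def field_simps)
      have "N = (q - p) * (q - Re z)"
        unfolding N_def using circ by algebra
      then have "Im z * N = Im z * ((q - p) * (q - Re z))" by simp
      then show "Im (of_real d * (z - of_real p)) = Im (\<i> * of_real (exp t) * (of_real q - z))"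
        using N \<open>q - p \<noteq> 0\<close> by (simp add: E d_def field_simps)
    qed
    moreover have "of_real 1 * (\<i> * of_real (exp t)) + of_real d \<noteq> (0::complex)"
      by (rule geodesic_denominator_nonzero[of "q * 1" d "p * d" 1]) (use d(1) in \<open>simp add: algebra_simps\<close>)
    ultimately have "geodesic_map (q * 1) (p * d) 1 d t = z"
      by (simp add: geodesic_map_def moebius_def divide_eq_eq algebra_simps)
    then show ?thesis by blast
  qed
  then show thesis
    using that[of "geodesic_map (q * 1) (p * d) 1 d"] geodesic_with_endsI[OF d(1)]
    unfolding pq by blast
qed

text \<open>This identity turns the angle of two geodesics at a common point into the algebraic
  invariant of the pair of forms.\<close>

lemma inner_form_at:
  assumes F: "on_geodesic F z" and G: "on_geodesic G z"
  shows "form_at F z \<bullet> form_at G z = (Im z)^2 * polar F G"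
proof -
  define x y where "x = Re z" and "y = Im z"
  have z: "Re z = x" "Im z = y" by (simp_all add: x_def y_def)
  have "coeff_xx F * (x^2 + y^2) + coeff_xy F * x + coeff_yy F = 0"
    "coeff_xx G * (x^2 + y^2) + coeff_xy G * x + coeff_yy G = 0"
    using F G by (auto simp: on_geodesic_def z)
  then show ?thesis
    unfolding inner_complex_def form_at_def polar_def
    by (simp add: power2_eq_square z) algebra
qed

lemma norm_form_at:
  assumes "on_geodesic F z"
  shows "norm (form_at F z) = Im z * sqrt (disc F)"
proof -
  have "norm (form_at F z) = sqrt ((Im z)^2 * disc F)"
    unfolding norm_eq_sqrt_inner inner_form_at[OF assms assms] polar_self ..
  then show ?thesis using assms by (simp add: real_sqrt_mult on_geodesic_def)
qed

text \<open>The Cauchy-Schwarz inequality for the two velocities. It shows in particular that the geodesics are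
  disjoint when the polar form exceeds the discriminant.\<close>

lemma abs_polar_le_of_common_point:
  assumes "on_geodesic F z" "on_geodesic G z" "disc F = D" "disc G = D" "D \<ge> 0"
  shows "\<bar>polar F G\<bar> \<le> D"
proof -
  have "Im z > 0" using assms(1) by (simp add: on_geodesic_def)
  have "(Im z)^2 * \<bar>polar F G\<bar> = \<bar>form_at F z \<bullet> form_at G z\<bar>"
    unfolding inner_form_at[OF assms(1,2)] by (simp add: abs_mult)
  also have "\<dots> \<le> norm (form_at F z) * norm (form_at G z)"
    by (rule Cauchy_Schwarz_ineq2)
  also have "\<dots> = (Im z)^2 * D"
    using assms by (simp add: norm_form_at power2_eq_square)
  finally show ?thesis using \<open>Im z > 0\<close> by simp
qed

text \<open>Eliminating \<open>\<bar>z\<bar>\<^sup>2\<close> from the two equations of semicircles gives \<open>Re z = B / A\<close>, and eliminating \<open>Re z\<close> gives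
  \<open>\<bar>z\<bar>\<^sup>2 = C / A\<close>. The solution lies in the half-plane if and only if \<open>A C > B\<^sup>2\<close>, and \<open>4 (A C - B\<^sup>2)\<close> is the
  difference of the two sides of the hypothesis. The discriminants need not agree,
  since the lemma is also applied to a geodesic and a perpendicular of it.\<close>

lemma ex_common_point:
  assumes l: "coeff_xx F \<noteq> 0" and lt: "(polar F G)^2 < disc F * disc G"
  shows "\<exists>z. on_geodesic F z \<and> on_geodesic G z"
proof -
  obtain l m r where F: "F = BQF l m r" by (cases F)
  obtain l' m' r' where G: "G = BQF l' m' r'" by (cases G)
  define A B C where "A = l * m' - l' * m" and "B = r * l' - r' * l" and "C = m * r' - m' * r"
  define R where "R = A * C - B^2"
  have R: "4 * R = disc F * disc G - (polar F G)^2"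
    unfolding R_def A_def B_def C_def F G by (simp add: disc_def polar_def power2_eq_square algebra_simps)
  then have "R > 0" using lt by simp
  then have A: "A \<noteq> 0" by (auto simp: R_def)
  define z where "z = Complex (B / A) (sqrt R / \<bar>A\<bar>)"
  have pos: "Im z > 0" using \<open>R > 0\<close> A by (simp add: z_def)
  have sq: "(Re z)^2 + (Im z)^2 = C / A"
    using \<open>R > 0\<close> A by (simp add: z_def power_divide R_def power2_eq_square field_simps)
  have "l * C + m * B + r * A = 0" "l' * C + m' * B + r' * A = 0"
    unfolding A_def B_def C_def by (simp_all add: algebra_simps)
  then have "l * (C / A) + m * (B / A) + r = 0" "l' * (C / A) + m' * (B / A) + r' = 0"
    using A by (simp_all add: field_simps)
  then have "on_geodesic F z" "on_geodesic G z"
    using pos sq by (simp_all add: on_geodesic_def F G) (simp_all add: z_def)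
  then show ?thesis by blast
qed

lemma vec_angle_velocities:
  assumes \<gamma>: "geodesic_with_ends (ends F) \<gamma>" and \<delta>: "geodesic_with_ends (ends G) \<delta>"
    and eq: "\<gamma> s = \<delta> t"
    and F: "coeff_xx F \<noteq> 0" "disc F = D" and G: "coeff_xx G \<noteq> 0" "disc G = D" and D: "D > 0"
  shows "vec_angle (velocity \<gamma> s) (velocity \<delta> t) = arccos (polar F G / D)"
    and "\<bar>polar F G\<bar> \<le> D"
proof -
  have on: "on_geodesic F (\<gamma> s)" "on_geodesic G (\<gamma> s)"
    using geodesic_with_ends_form(1)[OF \<gamma>, of s] geodesic_with_ends_form(1)[OF \<delta>, of t] F G D
    unfolding eq by simp_all
  have v: "velocity \<gamma> s = - form_at F (\<gamma> s) /\<^sub>R sqrt D"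
    "velocity \<delta> t = - form_at G (\<gamma> s) /\<^sub>R sqrt D"
    using geodesic_with_ends_form(2)[OF \<gamma>, of s] geodesic_with_ends_form(2)[OF \<delta>, of t] F G D
    unfolding eq by (simp_all add: scaleR_conv_of_real divide_inverse mult.commute)
  have "Im (\<gamma> s) > 0" using on(1) by (simp add: on_geodesic_def)
  then show "vec_angle (velocity \<gamma> s) (velocity \<delta> t) = arccos (polar F G / D)"
    unfolding vec_angle_def v
    using D by (simp add: norm_form_at[OF on(1)] norm_form_at[OF on(2)]
        inner_form_at[OF on] F(2) G(2) power2_eq_square divide_simps)
  show "\<bar>polar F G\<bar> \<le> D"
    using abs_polar_le_of_common_point[OF on F(2) G(2)] D by simp
qed

lemma cos_crossing_angle:
  assumes "crossing_angle (ends F) (ends G) \<theta>"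
    and F: "coeff_xx F \<noteq> 0" "disc F = D" and G: "coeff_xx G \<noteq> 0" "disc G = D" and D: "D > 0"
  shows "cos \<theta> = polar F G / D"
proof -
  obtain \<gamma> \<delta> s t where \<gamma>: "geodesic_with_ends (ends F) \<gamma>" and \<delta>: "geodesic_with_ends (ends G) \<delta>"
    and eq: "\<gamma> s = \<delta> t" and \<theta>: "\<theta> = vec_angle (velocity \<gamma> s) (velocity \<delta> t)"
    using assms(1) by (auto simp: crossing_angle_def)
  note angle = vec_angle_velocities[OF \<gamma> \<delta> eq F G D]
  have "\<bar>polar F G / D\<bar> \<le> 1" using angle(2) D by simp
  then show ?thesis unfolding \<theta> angle(1) by (rule cos_arccos_abs)
qed

lemma ex_crossing_angle:
  assumes F: "coeff_xx F \<noteq> 0" "disc F = D" and G: "coeff_xx G \<noteq> 0" "disc G = D" and D: "D > 0"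
    and lt: "\<bar>polar F G\<bar> < D"
  shows "\<exists>\<theta>. crossing_angle (ends F) (ends G) \<theta>"
proof -
  have "(polar F G)^2 < disc F * disc G"
    using lt power2_strict_mono[of "polar F G" D] D by (simp add: F G power2_eq_square)
  then obtain z where z: "on_geodesic F z" "on_geodesic G z"
    using ex_common_point F(1) by blast
  obtain \<gamma> where \<gamma>: "geodesic_with_ends (ends F) \<gamma>" "\<And>z. on_geodesic F z \<Longrightarrow> \<exists>t. \<gamma> t = z"
    using ex_geodesic_with_ends_form[of F] F D by blast
  obtain \<delta> where \<delta>: "geodesic_with_ends (ends G) \<delta>" "\<And>z. on_geodesic G z \<Longrightarrow> \<exists>t. \<delta> t = z"
    using ex_geodesic_with_ends_form[of G] G D by blast
  obtain s t where st: "\<gamma> s = z" "\<delta> t = z" using \<gamma>(2) \<delta>(2) z by blast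
  then have eq: "\<gamma> s = \<delta> t" by simp
  note angle = vec_angle_velocities(1)[OF \<gamma>(1) \<delta>(1) eq F G D]
  have "0 < arccos (polar F G / D)" "arccos (polar F G / D) < pi"
    using arccos_lt_bounded[of "polar F G / D"] lt D by (simp_all add: abs_less_iff divide_simps)
  then have "crossing_angle (ends F) (ends G) (vec_angle (velocity \<gamma> s) (velocity \<delta> t))"
    unfolding crossing_angle_def angle using \<gamma>(1) \<delta>(1) eq angle by metis
  then show ?thesis by blast
qed

section \<open>Common perpendiculars\<close>

text \<open>Along a geodesic \<open>\<sigma>\<close>, the position of another geodesic is read off from the pulled back form
  \<open>F'\<close> on the imaginary axis: with \<open>w = c i e\<^sup>t + d\<close>, the value \<open>F(\<sigma>(t), 1)\<close> is \<open>F'(i e\<^sup>t, 1) / w\<^sup>2\<close> and the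
  velocity of \<open>\<sigma>\<close> is \<open>i e\<^sup>t / w\<^sup>2\<close>, so that \<open>w\<close> contributes only a positive factor.\<close>

lemma form_at_geodesic_map:
  fixes F :: "real bqf"
  assumes det: "a * d - b * c = 1"
  defines "F' \<equiv> subst_form a b c d F"
  shows "on_geodesic F (geodesic_map a b c d t)
      \<longleftrightarrow> coeff_xx F' * (exp t)^2 + coeff_yy F' = 0"
    and "\<exists>k>0. cnj (velocity (geodesic_map a b c d) t) * form_at F (geodesic_map a b c d t)
      = of_real k * Complex (coeff_xy F' * exp t) (coeff_xx F' * (exp t)^2 - coeff_yy F')"
proof -
  define E where "E = exp t"
  obtain l m r where F: "F = BQF l m r" by (cases F)
  define w where "w = of_real c * (\<i> * of_real E) + (of_real d :: complex)"
  have w: "w \<noteq> 0" unfolding w_def E_def using det by (rule geodesic_denominator_nonzero)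
  define X where "X = of_real a * (\<i> * of_real E) + (of_real b :: complex)"
  define z where "z = geodesic_map a b c d t"
  have z: "z = X / w" by (simp add: z_def geodesic_map_def moebius_def w_def X_def E_def)
  have ri: "Re w = d" "Im w = c * E" "Re X = b" "Im X = a * E"
    by (simp_all add: w_def X_def)
  define N where "N = (Re w)^2 + (Im w)^2"
  have N: "N > 0" using w by (auto simp: N_def sum_power2_gt_zero_iff complex_eq_iff)
  have "Im z > 0" unfolding z_def using det by (rule Im_geodesic_map_pos)
  have "N * (l * ((Re z)^2 + (Im z)^2) + m * Re z + r)
      = l * ((Re X)^2 + (Im X)^2) + m * (Re X * Re w + Im X * Im w) + r * N"
  proof -
    have "(Re z)^2 + (Im z)^2 = ((Re X)^2 + (Im X)^2) / N"
      unfolding z N_def by (metis cmod_power2 norm_divide power_divide)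
    then have sq: "N * ((Re z)^2 + (Im z)^2) = (Re X)^2 + (Im X)^2"
      using N by simp
    have "Re z = (Re X * Re w + Im X * Im w) / N"
      unfolding z N_def by (simp add: Re_divide)
    then have re: "N * Re z = Re X * Re w + Im X * Im w"
      using N by simp
    show ?thesis unfolding sq[symmetric] re[symmetric] by (simp add: algebra_simps)
  qed
  also have "\<dots> = coeff_xx F' * E^2 + coeff_yy F'"
    unfolding N_def ri F'_def F
    by (simp add: subst_form_def bqf_eval_def power2_eq_square algebra_simps)
  finally have "l * ((Re z)^2 + (Im z)^2) + m * Re z + r = 0 \<longleftrightarrow> coeff_xx F' * E^2 + coeff_yy F' = 0"
    using N by (metis less_irrefl mult_eq_0_iff)
  then show "on_geodesic F (geodesic_map a b c d t) \<longleftrightarrow> coeff_xx F' * (exp t)^2 + coeff_yy F' = 0"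
    using \<open>Im z > 0\<close> unfolding z_def[symmetric] E_def[symmetric] by (simp add: on_geodesic_def F)
  have V: "velocity (geodesic_map a b c d) t = \<i> * of_real E / w^2"
    unfolding velocity_geodesic_map[OF det] by (simp add: E_def w_def)
  have "form_at F z = (of_real l * X^2 + of_real m * X * w + of_real r * w^2) / w^2"
    using w by (simp add: form_at_def F z field_simps power2_eq_square)
  also have "of_real l * X^2 + of_real m * X * w + of_real r * w^2
      = Complex (coeff_yy F' - coeff_xx F' * E^2) (coeff_xy F' * E)"
    by (rule complex_eqI)
      (simp_all add: ri power2_eq_square F'_def F subst_form_def bqf_eval_def algebra_simps)
  finally have "cnj (velocity (geodesic_map a b c d) t) * form_at F z
      = - \<i> * of_real E * Complex (coeff_yy F' - coeff_xx F' * E^2) (coeff_xy F' * E) / (w * cnj w)^2"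
    by (simp add: V power2_eq_square)
  also have "w * cnj w = of_real N"
    unfolding N_def by (simp add: complex_mult_cnj)
  also have "- \<i> * of_real E * Complex (coeff_yy F' - coeff_xx F' * E^2) (coeff_xy F' * E) / (of_real N)^2
     = of_real (E / N^2) * Complex (coeff_xy F' * E) (coeff_xx F' * E^2 - coeff_yy F')"
    using N by (simp add: complex_eq_iff field_simps flip: of_real_power)
  finally show "\<exists>k>0. cnj (velocity (geodesic_map a b c d) t) * form_at F (geodesic_map a b c d t)
      = of_real k * Complex (coeff_xy F' * exp t) (coeff_xx F' * (exp t)^2 - coeff_yy F')"
    unfolding z_def[symmetric] E_def[symmetric] using N
    by (intro exI[of _ "E / N^2"]) (simp add: E_def)
qed

lemma crossing_geodesic_map:
  fixes F :: "real bqf"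
  assumes det: "a * d - b * c = 1" and \<gamma>: "geodesic_with_ends (ends F) \<gamma>"
    and F: "coeff_xx F \<noteq> 0" "disc F > 0" and eq: "geodesic_map a b c d t = \<gamma> s"
  defines "F' \<equiv> subst_form a b c d F" and "V \<equiv> velocity (geodesic_map a b c d) t"
  shows "coeff_yy F' = - coeff_xx F' * (exp t)^2"
    and "orthogonal V (velocity \<gamma> s) \<longleftrightarrow> coeff_xy F' = 0"
    and "Im (cnj V * velocity \<gamma> s) > 0 \<longleftrightarrow> coeff_xx F' < 0"
proof -
  have "on_geodesic F (geodesic_map a b c d t)"
    unfolding eq by (rule geodesic_with_ends_form(1)[OF \<gamma> F])
  then have yy: "coeff_xx F' * (exp t)^2 + coeff_yy F' = 0"
    unfolding form_at_geodesic_map(1)[OF det] F'_def .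
  then show "coeff_yy F' = - coeff_xx F' * (exp t)^2" by simp
  obtain k where k: "k > 0" "cnj V * form_at F (geodesic_map a b c d t)
      = of_real k * Complex (coeff_xy F' * exp t) (coeff_xx F' * (exp t)^2 - coeff_yy F')"
    using form_at_geodesic_map(2)[OF det, of t F] unfolding F'_def V_def by blast
  define K where "K = k / sqrt (disc F)"
  have K: "K > 0" using k F by (simp add: K_def)
  have "cnj V * velocity \<gamma> s = - (cnj V * form_at F (geodesic_map a b c d t)) / of_real (sqrt (disc F))"
    unfolding geodesic_with_ends_form(2)[OF \<gamma> F] eq by simp
  also have "\<dots> = - of_real K * Complex (coeff_xy F' * exp t) (coeff_xx F' * (exp t)^2 - coeff_yy F')"
    unfolding k(2) K_def by simp
  also have "coeff_xx F' * (exp t)^2 - coeff_yy F' = 2 * coeff_xx F' * (exp t)^2"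
    using yy by simp
  finally have eq': "cnj V * velocity \<gamma> s
      = - of_real K * Complex (coeff_xy F' * exp t) (2 * coeff_xx F' * (exp t)^2)" .
  have "V \<bullet> velocity \<gamma> s = Re (cnj V * velocity \<gamma> s)"
    by (simp add: inner_complex_def)
  then show "orthogonal V (velocity \<gamma> s) \<longleftrightarrow> coeff_xy F' = 0"
    using K by (simp add: orthogonal_def eq')
  show "Im (cnj V * velocity \<gamma> s) > 0 \<longleftrightarrow> coeff_xx F' < 0"
    using K by (simp add: eq' mult_less_0_iff zero_less_mult_iff)
qed

text \<open>After the pull-back the forms are \<open>u (x\<^sup>2 - y\<^sup>2)\<close> and \<open>v (x\<^sup>2 - E\<^sup>2 y\<^sup>2)\<close> with \<open>E = e\<^sup>\<lambda>\<close>. Equality of the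
  discriminants gives \<open>u v = \<plusminus> D / (4 E)\<close>, the co-orientation selects the sign \<open>+\<close>, and the polar form
  \<open>2 u v (1 + E\<^sup>2)\<close> becomes \<open>D (E + 1/E) / 2\<close>.\<close>

lemma cosh_cooriented_perpendicular:
  assumes perp: "cooriented_perpendicular (ends F) (ends G) ell"
    and F: "coeff_xx F \<noteq> 0" "disc F = D" and G: "coeff_xx G \<noteq> 0" "disc G = D" and D: "D > 0"
  shows "cosh ell = polar F G / D"
proof -
  obtain \<gamma> \<delta> \<sigma> s t where \<gamma>: "geodesic_with_ends (ends F) \<gamma>" and \<delta>: "geodesic_with_ends (ends G) \<delta>"
    and \<sigma>: "hyp_geodesic \<sigma>" and eq: "\<sigma> 0 = \<gamma> s" "\<sigma> ell = \<delta> t"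
    and orth: "orthogonal (velocity \<sigma> 0) (velocity \<gamma> s)"
      "orthogonal (velocity \<sigma> ell) (velocity \<delta> t)"
    and co: "Im (cnj (velocity \<sigma> 0) * velocity \<gamma> s) > 0 \<longleftrightarrow>
         Im (cnj (velocity \<sigma> ell) * velocity \<delta> t) > 0"
    using perp by (auto simp: cooriented_perpendicular_def)
  obtain a b c d where det: "a * d - b * c = 1" and \<sigma>': "\<sigma> = geodesic_map a b c d"
    using \<sigma> by (auto simp: hyp_geodesic_iff)
  have F': "disc F > 0" and G': "disc G > 0" using F G D by auto
  note cF = crossing_geodesic_map[OF det \<gamma> F(1) F' eq(1)[unfolded \<sigma>']]
  note cG = crossing_geodesic_map[OF det \<delta> G(1) G' eq(2)[unfolded \<sigma>']]
  define u v E where "u = coeff_xx (subst_form a b c d F)" and "v = coeff_xx (subst_form a b c d G)"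
    and "E = exp ell"
  have xy: "coeff_xy (subst_form a b c d F) = 0" "coeff_xy (subst_form a b c d G) = 0"
    using orth cF(2) cG(2) unfolding \<sigma>' by auto
  have yy: "coeff_yy (subst_form a b c d F) = - u" "coeff_yy (subst_form a b c d G) = - v * E^2"
    using cF(1) cG(1) by (simp_all add: u_def v_def E_def)
  have "disc (subst_form a b c d F) = D" "disc (subst_form a b c d G) = D"
    by (simp_all add: disc_subst_form det F G)
  then have D': "4 * u^2 = D" "4 * v^2 * E^2 = D"
    by (simp_all add: disc_def xy yy power2_eq_square flip: u_def v_def)
  have "E > 0" by (simp add: E_def)
  have "u \<noteq> 0" "v \<noteq> 0" using D' D by auto
  moreover have "u < 0 \<longleftrightarrow> v < 0"
    using co cF(3) cG(3) unfolding \<sigma>' u_def v_def by simp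
  ultimately have "u * v > 0" by (auto simp: zero_less_mult_iff)
  then have "4 * (u * v) * E > 0" using \<open>E > 0\<close> by simp
  moreover have "(4 * (u * v) * E)^2 = D^2"
    using arg_cong2[OF D', of "(*)"] by (simp add: power2_eq_square algebra_simps)
  ultimately have uv: "4 * (u * v) * E = D"
    using D unfolding power2_eq_iff by linarith
  have "polar F G = polar (subst_form a b c d F) (subst_form a b c d G)"
    by (simp add: polar_subst_form det)
  also have "\<dots> = 2 * (u * v) * (1 + E^2)"
    by (simp add: polar_def xy yy algebra_simps flip: u_def v_def)
  also have "\<dots> = D * ((E + 1 / E) / 2)"
    unfolding uv[symmetric] using \<open>E > 0\<close> by (simp add: field_simps power2_eq_square)
  also have "(E + 1 / E) / 2 = cosh ell"
    by (simp add: cosh_def E_def exp_minus inverse_eq_divide)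
  finally show ?thesis using D by simp
qed

lemma hyp_geodesic_shift:
  assumes "hyp_geodesic \<sigma>"
  shows "hyp_geodesic (\<lambda>t. \<sigma> (s + t))"
proof -
  obtain a b c d where det: "a * d - b * c = 1" and \<sigma>: "\<sigma> = geodesic_map a b c d"
    using assms by (auto simp: hyp_geodesic_iff)
  \<comment> \<open>a time shift by \<open>s\<close> is right multiplication by the diagonal matrix \<open>(h, 1/h)\<close>\<close>
  define h where "h = exp (s / 2)"
  have h: "h > 0" "exp s = h * h" by (simp_all add: h_def flip: exp_add)
  have "(a * h) * (d / h) - (b / h) * (c * h) = 1" using h det by simp
  moreover have "\<sigma> (s + t) = geodesic_map (a * h) (b / h) (c * h) (d / h) t" for t
  proof -
    have eq: "x * (\<i> * of_real (exp (s + t))) + y = of_real h * (x * of_real h * (\<i> * of_real (exp t)) + y / of_real h)"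
      for x y :: complex
      using h by (simp add: exp_add field_simps)
    show ?thesis
      unfolding \<sigma> geodesic_map_def moebius_def eq using h by simp
  qed
  ultimately show ?thesis unfolding hyp_geodesic_iff fun_eq_iff by blast
qed

lemma hyp_geodesic_reverse:
  assumes "hyp_geodesic \<sigma>"
  shows "hyp_geodesic (\<lambda>t. \<sigma> (- t))"
proof -
  obtain a b c d where det: "a * d - b * c = 1" and \<sigma>: "\<sigma> = geodesic_map a b c d"
    using assms by (auto simp: hyp_geodesic_iff)
  \<comment> \<open>time reversal is right multiplication by the rotation \<open>z \<mapsto> -1/z\<close>\<close>
  have "b * (- c) - (- a) * d = 1" using det by simp
  moreover have "\<sigma> (- t) = geodesic_map b (- a) d (- c) t" for t
  proof -
    have eq: "x * (\<i> * of_real (exp (- t))) + y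
        = (y * (\<i> * of_real (exp t)) + - x) / (\<i> * of_real (exp t))" for x y :: complex
      by (simp add: exp_minus field_simps)
    show ?thesis unfolding \<sigma> geodesic_map_def moebius_def eq by simp
  qed
  ultimately show ?thesis unfolding hyp_geodesic_iff fun_eq_iff by blast
qed

lemma hyp_geodesic_has_velocity:
  assumes "hyp_geodesic \<sigma>"
  shows "(\<sigma> has_vector_derivative velocity \<sigma> t) (at t)"
  using assms has_vector_derivative_geodesic_map
  by (auto simp: hyp_geodesic_iff velocity_geodesic_map)

lemma velocity_shift:
  assumes "hyp_geodesic \<sigma>"
  shows "velocity (\<lambda>t. \<sigma> (s + t)) t = velocity \<sigma> (s + t)"
proof -
  have "((\<lambda>t. s + t) has_vector_derivative 1) (at t)"
    by (auto intro!: derivative_eq_intros)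
  from vector_diff_chain_at[OF this hyp_geodesic_has_velocity[OF assms]] show ?thesis
    by (auto simp: velocity_def[of "\<lambda>t. \<sigma> (s + t)"] o_def intro!: vector_derivative_at)
qed

lemma velocity_reverse:
  assumes "hyp_geodesic \<sigma>"
  shows "velocity (\<lambda>t. \<sigma> (- t)) t = - velocity \<sigma> (- t)"
proof -
  have "((\<lambda>t. - t) has_vector_derivative - 1) (at t)"
    by (auto intro!: derivative_eq_intros)
  from vector_diff_chain_at[OF this hyp_geodesic_has_velocity[OF assms]] show ?thesis
    by (auto simp: velocity_def[of "\<lambda>t. \<sigma> (- t)"] o_def intro!: vector_derivative_at)
qed

text \<open>The same computation read backwards: the sign of the polar form is that of \<open>u v\<close>.\<close>

lemma coorientation_of_polar_pos:
  assumes det: "a * d - b * c = 1"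
    and \<gamma>: "geodesic_with_ends (ends F) \<gamma>" and F: "coeff_xx F \<noteq> 0" "disc F > 0"
    and \<delta>: "geodesic_with_ends (ends G) \<delta>" and G: "coeff_xx G \<noteq> 0" "disc G > 0"
    and eq: "geodesic_map a b c d u = \<gamma> s" "geodesic_map a b c d v = \<delta> t"
    and orth: "orthogonal (velocity (geodesic_map a b c d) u) (velocity \<gamma> s)"
      "orthogonal (velocity (geodesic_map a b c d) v) (velocity \<delta> t)"
    and pos: "polar F G > 0"
  shows "Im (cnj (velocity (geodesic_map a b c d) u) * velocity \<gamma> s) > 0 \<longleftrightarrow>
         Im (cnj (velocity (geodesic_map a b c d) v) * velocity \<delta> t) > 0"
proof -
  note cF = crossing_geodesic_map[OF det \<gamma> F eq(1)]
  note cG = crossing_geodesic_map[OF det \<delta> G eq(2)]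
  define x y where "x = coeff_xx (subst_form a b c d F)" and "y = coeff_xx (subst_form a b c d G)"
  have "polar F G = polar (subst_form a b c d F) (subst_form a b c d G)"
    by (simp add: polar_subst_form det)
  also have "\<dots> = x * y * (2 * ((exp u)^2 + (exp v)^2))"
    using orth cF(1,2) cG(1,2) by (simp add: polar_def x_def y_def algebra_simps)
  finally have "x * y * (2 * ((exp u)^2 + (exp v)^2)) > 0" using pos by simp
  moreover have "(exp u)^2 + (exp v)^2 > 0" by (simp add: add_pos_pos)
  ultimately have "x * y > 0" by (simp add: zero_less_mult_iff)
  then show ?thesis
    unfolding cF(3) cG(3) x_def[symmetric] y_def[symmetric] by (auto simp: zero_less_mult_iff)
qed

text \<open>The Jacobian determinant of two forms, up to a constant factor. When the forms are
  independent it spans those orthogonal to both for \<open>polar\<close>, so its geodesic is the complete geodesic that carries the common perpendicular.\<close>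

definition jacobian :: "real bqf \<Rightarrow> real bqf \<Rightarrow> real bqf" where
  "jacobian F G = BQF (coeff_xx F * coeff_xy G - coeff_xx G * coeff_xy F)
     (2 * (coeff_xx F * coeff_yy G - coeff_xx G * coeff_yy F))
     (coeff_xy F * coeff_yy G - coeff_xy G * coeff_yy F)"

lemma polar_jacobian: "polar (jacobian F G) F = 0" "polar (jacobian F G) G = 0"
  by (simp_all add: polar_def jacobian_def algebra_simps)

lemma disc_jacobian: "disc (jacobian F G) = (polar F G)^2 - disc F * disc G"
  by (simp add: polar_def disc_def jacobian_def power2_eq_square algebra_simps)

text \<open>The geodesic of the Jacobian form meets both geodesics, at right angles because the polar forms
  vanish. It is shifted so as to start on the first one, after a reversal if it met the second one
  earlier. The hypothesis on the Jacobian keeps the ends of the perpendicular finite; the pairs of lifts to which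
  the lemma is applied can be chosen to satisfy it.\<close>

lemma ex_cooriented_perpendicular:
  assumes F: "coeff_xx F \<noteq> 0" "disc F = D" and G: "coeff_xx G \<noteq> 0" "disc G = D" and D: "D > 0"
    and gt: "polar F G > D" and J: "coeff_xx (jacobian F G) \<noteq> 0"
  shows "\<exists>ell. cooriented_perpendicular (ends F) (ends G) ell"
proof -
  define J where "J = jacobian F G"
  have "(polar F G)^2 > D^2" using gt D by (simp add: power_strict_mono)
  then have discJ: "disc J > 0" by (simp add: J_def disc_jacobian F G power2_eq_square)
  have J0: "coeff_xx J \<noteq> 0" using J by (simp add: J_def)
  obtain z where z: "on_geodesic J z" "on_geodesic F z"
    using ex_common_point[of J F] discJ J0 D by (auto simp: J_def polar_jacobian F)
  obtain w where w: "on_geodesic J w" "on_geodesic G w"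
    using ex_common_point[of J G] discJ J0 D by (auto simp: J_def polar_jacobian G)
  obtain \<gamma> s where \<gamma>: "geodesic_with_ends (ends F) \<gamma>" "\<gamma> s = z"
    using ex_geodesic_with_ends_form[of F] F D z(2) by metis
  obtain \<delta> t where \<delta>: "geodesic_with_ends (ends G) \<delta>" "\<delta> t = w"
    using ex_geodesic_with_ends_form[of G] G D w(2) by metis
  obtain \<tau> where \<tau>: "geodesic_with_ends (ends J) \<tau>" "\<And>z. on_geodesic J z \<Longrightarrow> \<exists>t. \<tau> t = z"
    using ex_geodesic_with_ends_form[OF J0 discJ] by blast
  obtain u v where uv: "\<tau> u = z" "\<tau> v = w" using \<tau>(2) z w by metis
  have hyp\<tau>: "hyp_geodesic \<tau>" using \<tau>(1) by (simp add: geodesic_with_ends_def)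
  have onF: "on_geodesic F (\<gamma> x)" and onG: "on_geodesic G (\<delta> x)" for x
    using geodesic_with_ends_form(1)[OF \<gamma>(1), of x] geodesic_with_ends_form(1)[OF \<delta>(1), of x] F G D
    by auto
  have no_common: False if "on_geodesic F x" "on_geodesic G x" for x
    using abs_polar_le_of_common_point[OF that F(2) G(2)] D gt by simp
  have disj: "range \<gamma> \<inter> range \<delta> = {}" using no_common onF onG by auto metis
  have "u \<noteq> v" using no_common uv z w by auto
  have orth_form: "orthogonal (form_at J x / of_real (sqrt (disc J))) (form_at H x / of_real (sqrt (disc H)))"
    if "on_geodesic J x" "on_geodesic H x" "polar J H = 0" for H x
    using inner_form_at[OF that(1,2)] that(3)
    by (simp add: orthogonal_def divide_inverse mult.commute[of _ "of_real _"] flip: of_real_inverse scaleR_conv_of_real)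
  have orth: "orthogonal (velocity \<tau> u) (velocity \<gamma> s)" "orthogonal (velocity \<tau> v) (velocity \<delta> t)"
    using orth_form[OF z] orth_form[OF w] F G D polar_jacobian[of F G] J0 discJ
    by (simp_all add: geodesic_with_ends_form(2)[OF \<tau>(1)] geodesic_with_ends_form(2)[OF \<gamma>(1)]
        geodesic_with_ends_form(2)[OF \<delta>(1)] uv \<gamma> \<delta> orthogonal_clauses flip: J_def)
  have "\<exists>\<sigma>. hyp_geodesic \<sigma> \<and> \<sigma> 0 = z \<and> \<sigma> \<bar>v - u\<bar> = w \<and>
     orthogonal (velocity \<sigma> 0) (velocity \<gamma> s) \<and> orthogonal (velocity \<sigma> \<bar>v - u\<bar>) (velocity \<delta> t)"
  proof (cases "u < v")
    case True
    then show ?thesis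
      using hyp_geodesic_shift[OF hyp\<tau>, of u] velocity_shift[OF hyp\<tau>, of u] uv orth
      by (intro exI[of _ "\<lambda>t. \<tau> (u + t)"]) simp
  next
    case False
    define \<rho> where "\<rho> t = \<tau> (- t)" for t
    have \<rho>: "hyp_geodesic \<rho>" "velocity \<rho> t = - velocity \<tau> (- t)" for t
      using hyp_geodesic_reverse[OF hyp\<tau>] velocity_reverse[OF hyp\<tau>, of t] by (simp_all add: \<rho>_def[abs_def])
    show ?thesis
      using hyp_geodesic_shift[OF \<rho>(1), of "- u"] velocity_shift[OF \<rho>(1), of "- u"] uv orth False \<rho>(2)
      by (intro exI[of _ "\<lambda>t. \<rho> (- u + t)"]) (simp add: \<rho>_def orthogonal_clauses)
  qed
  then obtain \<sigma> where \<sigma>: "hyp_geodesic \<sigma>" "\<sigma> 0 = \<gamma> s" "\<sigma> \<bar>v - u\<bar> = \<delta> t"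
     "orthogonal (velocity \<sigma> 0) (velocity \<gamma> s)" "orthogonal (velocity \<sigma> \<bar>v - u\<bar>) (velocity \<delta> t)"
    using \<gamma> \<delta> by metis
  obtain a b c d where det: "a * d - b * c = 1" and \<sigma>': "\<sigma> = geodesic_map a b c d"
    using \<sigma>(1) by (auto simp: hyp_geodesic_iff)
  have "Im (cnj (velocity \<sigma> 0) * velocity \<gamma> s) > 0 \<longleftrightarrow>
         Im (cnj (velocity \<sigma> \<bar>v - u\<bar>) * velocity \<delta> t) > 0"
    unfolding \<sigma>'
    by (rule coorientation_of_polar_pos[OF det \<gamma>(1) _ _ \<delta>(1)]) (use \<sigma> F G D gt \<sigma>' in auto)
  then have "cooriented_perpendicular (ends F) (ends G) \<bar>v - u\<bar>"
    unfolding cooriented_perpendicular_def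
    using \<gamma>(1) \<delta>(1) disj \<sigma> \<open>u \<noteq> v\<close> by (intro conjI exI[of _ \<gamma>] exI[of _ \<delta>] exI[of _ \<sigma>] exI[of _ s] exI[of _ t]) auto
  then show ?thesis by blast
qed

section \<open>Lifts of a modular geodesic as integral forms\<close>

lemma form_ends_eq_ends: "form_ends Q = ends (map_bqf of_int Q)"
  by (simp add: form_ends_def ends_def disc_map_bqf)

lemma coeff_xx_nonzero:
  assumes "\<nexists>k. disc Q = k^2"
  shows "coeff_xx Q \<noteq> (0::int)"
  using assms by (auto simp: disc_def)

text \<open>Both signs of \<open>s\<close> are covered at once: a matrix of determinant 1 sends the root with a given sign of the square
  root to the root of the transformed form with the same sign, so the orientation is preserved.\<close>

lemma moebius_root:
  fixes a b c d l m r s :: real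
  defines "l' \<equiv> l * d^2 - m * c * d + r * c^2"
    and "m' \<equiv> m * (a * d + b * c) - 2 * l * b * d - 2 * r * a * c"
  assumes det: "a * d - b * c = 1" and s: "s^2 = m^2 - 4 * l * r" and l: "l \<noteq> 0" and l': "l' \<noteq> 0"
  shows "moebius a b c d ((- m + s) / (2 * l)) = (- m' + s) / (2 * l')"
proof -
  define X w where "X = a * (- m + s) + b * (2 * l)" and "w = c * (- m + s) + d * (2 * l)"
  have "w * (c * (- m - s) + d * (2 * l)) = 4 * l * l'"
    unfolding w_def l'_def using s by algebra
  then have w: "w \<noteq> 0" using l l' by auto
  have "(2 * l') * X = (- m' + s) * w"
    unfolding X_def w_def l'_def m'_def using s det by algebra
  then have "X / w = (- m' + s) / (2 * l')"
    using w l' by (simp add: field_simps)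
  moreover have "moebius a b c d ((- m + s) / (2 * l)) = (X / (2 * l)) / (w / (2 * l))"
    unfolding moebius_def X_def w_def using l by (simp add: add_divide_distrib)
  ultimately show ?thesis using l by simp
qed

lemma geodesic_act_form_ends:
  assumes det: "det g = 1" and disc: "disc Q > 0" and nonsquare: "\<nexists>k. disc Q = k^2"
  defines "P \<equiv> subst_form (g$2$2) (- (g$1$2)) (- (g$2$1)) (g$1$1) Q"
  shows "geodesic_act g (form_ends Q) = form_ends P" and "psl2_equivalent Q P"
proof -
  have det': "g$1$1 * g$2$2 - g$1$2 * g$2$1 = 1" using det by (simp add: det_2)
  show "psl2_equivalent Q P"
    unfolding P_def by (rule psl2_equivalent_subst_form) (use det' in \<open>simp add: algebra_simps\<close>)
  then have discP: "disc P = disc Q" by (rule disc_psl2_equivalent)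
  obtain l m r where Q: "Q = BQF l m r" by (cases Q)
  have l: "coeff_xx Q \<noteq> 0" and l': "coeff_xx P \<noteq> 0"
    using coeff_xx_nonzero nonsquare discP by simp_all
  have rdet: "real_of_int (g$1$1) * real_of_int (g$2$2) - real_of_int (g$1$2) * real_of_int (g$2$1) = 1"
    using arg_cong[OF det', of real_of_int] by simp
  have coeffs: "real_of_int (coeff_xx P)
      = of_int l * (of_int (g$2$2))^2 - of_int m * of_int (g$2$1) * of_int (g$2$2) + of_int r * (of_int (g$2$1))^2"
    "real_of_int (coeff_xy P)
      = of_int m * (of_int (g$1$1) * of_int (g$2$2) + of_int (g$1$2) * of_int (g$2$1))
        - 2 * of_int l * of_int (g$1$2) * of_int (g$2$2) - 2 * of_int r * of_int (g$1$1) * of_int (g$2$1)"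
    by (simp_all add: P_def Q subst_form_def bqf_eval_def algebra_simps)
  have root: "boundary_act g ((- of_int (coeff_xy Q) + s) / (2 * of_int (coeff_xx Q)))
      = (- of_int (coeff_xy P) + s) / (2 * of_int (coeff_xx P))"
    if "s^2 = of_int (disc Q)" for s
    unfolding boundary_act_def coeffs Q bqf.sel
    by (rule moebius_root[OF rdet]) (use that l l' in \<open>simp_all add: Q disc_def flip: coeffs\<close>)
  show "geodesic_act g (form_ends Q) = form_ends P"
    unfolding geodesic_act_def form_ends_def fst_conv snd_conv discP
    using root[of "sqrt (of_int (disc Q))"] root[of "- sqrt (of_int (disc Q))"] disc by simp
qed

text \<open>Lifts are thus handled as integral forms, on which the polar form is defined.\<close>

lemma lifts_eq:
  assumes disc: "disc Q > 0" and nonsquare: "\<nexists>k. disc Q = k^2"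
  shows "lifts Q = {form_ends P | P. psl2_equivalent Q P}"
proof (intro equalityI subsetI)
  fix A assume "A \<in> lifts Q"
  then show "A \<in> {form_ends P | P. psl2_equivalent Q P}"
    using geodesic_act_form_ends[OF _ disc nonsquare] by (auto simp: lifts_def)
next
  fix A assume "A \<in> {form_ends P | P. psl2_equivalent Q P}"
  then obtain a b c d where det: "a * d - b * c = 1" and A: "A = form_ends (subst_form a b c d Q)"
    by (auto simp: psl2_equivalent_iff_subst_form)
  define g :: "int^2^2" where "g = vector [vector [d, - b], vector [- c, a]]"
  have g: "g$1$1 = d" "g$1$2 = - b" "g$2$1 = - c" "g$2$2 = a" by (simp_all add: g_def)
  have dg: "det g = 1" using det by (simp add: det_2 g algebra_simps)
  have "A = geodesic_act g (form_ends Q)"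
    using geodesic_act_form_ends(1)[OF dg disc nonsquare] by (simp add: A g)
  with dg show "A \<in> lifts Q" by (auto simp: lifts_def)
qed

text \<open>A property of an orbit witnessed by one of its members is a property of a pair of forms; stated for an
  arbitrary relation so as to apply to angles and to lengths.\<close>

lemma orbits_of_pairs_of_lifts:
  fixes C :: "real \<times> real \<Rightarrow> real \<times> real \<Rightarrow> real \<Rightarrow> bool"
  assumes Qa: "disc Qa > 0" "\<nexists>k. disc Qa = k^2" and Qb: "disc Qb > 0" "\<nexists>k. disc Qb = k^2"
  defines "Orb \<equiv> {diagonal_orbit (A, B) | A B. A \<in> lifts Qa \<and> B \<in> lifts Qb \<and> (\<exists>t. C A B t)}"
  shows "(\<exists>I \<in> Orb. \<exists>(A, B) \<in> I. C A B t)
    \<longleftrightarrow> (\<exists>P R. psl2_equivalent Qa P \<and> psl2_equivalent Qb R \<and> C (form_ends P) (form_ends R) t)"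
proof
  assume "\<exists>I \<in> Orb. \<exists>(A, B) \<in> I. C A B t"
  then obtain P R g where P: "psl2_equivalent Qa P" and R: "psl2_equivalent Qb R" and g: "det g = 1"
    and C: "C (geodesic_act g (form_ends P)) (geodesic_act g (form_ends R)) t"
    by (auto simp: Orb_def lifts_eq[OF Qa] lifts_eq[OF Qb] diagonal_orbit_def)
  have "disc P = disc Qa" "disc R = disc Qb"
    using P R disc_psl2_equivalent by auto
  then obtain P' R' where "geodesic_act g (form_ends P) = form_ends P'" "psl2_equivalent P P'"
    "geodesic_act g (form_ends R) = form_ends R'" "psl2_equivalent R R'"
    using geodesic_act_form_ends[OF g] Qa Qb by metis
  with P R C show "\<exists>P R. psl2_equivalent Qa P \<and> psl2_equivalent Qb R \<and> C (form_ends P) (form_ends R) t"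
    using psl2_equivalent_trans by metis
next
  assume "\<exists>P R. psl2_equivalent Qa P \<and> psl2_equivalent Qb R \<and> C (form_ends P) (form_ends R) t"
  then obtain P R where PR: "psl2_equivalent Qa P" "psl2_equivalent Qb R" "C (form_ends P) (form_ends R) t"
    by blast
  have "geodesic_act (mat 1) A = A" for A
    by (simp add: geodesic_act_def boundary_act_def moebius_def mat_def)
  then have "(form_ends P, form_ends R) \<in> diagonal_orbit (form_ends P, form_ends R)"
    unfolding diagonal_orbit_def by (intro CollectI exI[of _ "mat 1"]) simp
  moreover have "diagonal_orbit (form_ends P, form_ends R) \<in> Orb"
    unfolding Orb_def lifts_eq[OF Qa] lifts_eq[OF Qb] using PR by blast
  ultimately show "\<exists>I \<in> Orb. \<exists>(A, B) \<in> I. C A B t" using PR(3) by blast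
qed

section \<open>Reduction: crossing lifts and distant lifts\<close>

text \<open>The geodesic runs from a negative to a positive number, that is, it crosses the imaginary axis from left to
  right.\<close>

definition indefinite_simple :: "int bqf \<Rightarrow> bool" where
  "indefinite_simple Q \<longleftrightarrow> coeff_xx Q > 0 \<and> coeff_yy Q < 0"

lemma psl2_equivalent_steps:
  fixes l m r k :: "'a::comm_ring_1"
  shows "psl2_equivalent (BQF l m r) (BQF l (m + 2 * l * k) (l * k^2 + m * k + r))"
    and "psl2_equivalent (BQF l m r) (BQF (l + m * k + r * k^2) (m + 2 * r * k) r)"
    and "psl2_equivalent (BQF l m r) (BQF r (- m) l)"
proof -
  have "psl2_equivalent (BQF l m r) (subst_form 1 k 0 1 (BQF l m r))"
    "psl2_equivalent (BQF l m r) (subst_form 1 0 k 1 (BQF l m r))"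
    "psl2_equivalent (BQF l m r) (subst_form 0 (- 1) 1 0 (BQF l m r))"
    by (rule psl2_equivalent_subst_form; simp)+
  then show "psl2_equivalent (BQF l m r) (BQF l (m + 2 * l * k) (l * k^2 + m * k + r))"
    "psl2_equivalent (BQF l m r) (BQF (l + m * k + r * k^2) (m + 2 * r * k) r)"
    "psl2_equivalent (BQF l m r) (BQF r (- m) l)"
    by (simp_all add: subst_form_def bqf_eval_def algebra_simps)
qed

text \<open>A form with \<open>\<bar>m\<bar>\<close> minimal in its class satisfies \<open>\<bar>m\<bar> \<le> \<bar>l\<bar>\<close> and \<open>\<bar>m\<bar> \<le> \<bar>r\<bar>\<close>; then
  \<open>l r > 0\<close> would give \<open>m\<^sup>2 \<le> l r\<close> and a negative discriminant.\<close>

lemma ex_simple_form: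
  assumes disc: "disc Q > 0" and nonsquare: "\<nexists>k. disc Q = k^2"
  shows "\<exists>P. psl2_equivalent Q P \<and> indefinite_simple P"
proof -
  obtain P where QP: "psl2_equivalent Q P"
    and least: "\<And>P'. psl2_equivalent Q P' \<Longrightarrow> nat \<bar>coeff_xy P\<bar> \<le> nat \<bar>coeff_xy P'\<bar>"
    using ex_has_least_nat[of "psl2_equivalent Q" Q "\<lambda>P. nat \<bar>coeff_xy P\<bar>"] psl2_equivalent_refl by metis
  obtain l m r where P: "P = BQF l m r" by (cases P)
  have "\<bar>m\<bar> \<le> \<bar>m + 2 * l * k\<bar>" "\<bar>m\<bar> \<le> \<bar>m + 2 * r * k\<bar>" for k
    using least[OF psl2_equivalent_trans[OF QP[unfolded P] psl2_equivalent_steps(1)], of k]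
      least[OF psl2_equivalent_trans[OF QP[unfolded P] psl2_equivalent_steps(2)], of k]
    unfolding P bqf.sel by linarith+
  from this[of 1] this[of "-1"] have "\<bar>m\<bar> \<le> \<bar>m + 2 * l\<bar>" "\<bar>m\<bar> \<le> \<bar>m - 2 * l\<bar>"
    "\<bar>m\<bar> \<le> \<bar>m + 2 * r\<bar>" "\<bar>m\<bar> \<le> \<bar>m - 2 * r\<bar>" by simp_all
  then have le: "\<bar>m\<bar> \<le> \<bar>l\<bar> \<or> l = 0" "\<bar>m\<bar> \<le> \<bar>r\<bar> \<or> r = 0" by linarith+
  have D: "m^2 - 4 * l * r = disc Q"
    using disc_psl2_equivalent[OF QP] by (simp add: P disc_def)
  have lr0: "l \<noteq> 0" "r \<noteq> 0"
    using D nonsquare by (metis diff_zero mult_zero_right mult_zero_left)+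
  have "l * r < 0"
  proof (rule ccontr)
    assume "\<not> l * r < 0"
    then have "l * r = \<bar>l\<bar> * \<bar>r\<bar>" by (simp flip: abs_mult)
    moreover have "\<bar>m\<bar> * \<bar>m\<bar> \<le> \<bar>l\<bar> * \<bar>r\<bar>" using le lr0 by (intro mult_mono) auto
    ultimately have "m^2 \<le> l * r" by (simp add: power2_eq_square flip: abs_mult)
    moreover have "0 \<le> m^2" by simp
    ultimately show False using D disc by simp
  qed
  then consider "l > 0" "r < 0" | "r > 0" "l < 0" by (auto simp: mult_less_0_iff)
  then show ?thesis
  proof cases
    case 1
    then show ?thesis using QP by (auto simp: P indefinite_simple_def)
  next
    case 2
    then show ?thesis
      using psl2_equivalent_trans[OF QP[unfolded P] psl2_equivalent_steps(3)]
      by (auto simp: indefinite_simple_def)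
  qed
qed

lemma no_unit_zero:
  fixes l m r :: int
  assumes "\<nexists>k. m^2 - 4 * l * r = k^2"
  shows "l + m + r \<noteq> 0" "l - m + r \<noteq> 0"
proof -
  show "l + m + r \<noteq> 0"
  proof
    assume "l + m + r = 0"
    then have "m = - (l + r)" by linarith
    then have "m^2 - 4 * l * r = (l - r)^2" by algebra
    then show False using assms by blast
  qed
  show "l - m + r \<noteq> 0"
  proof
    assume "l - m + r = 0"
    then have "m = l + r" by linarith
    then have "m^2 - 4 * l * r = (l - r)^2" by algebra
    then show False using assms by blast
  qed
qed

text \<open>Among the simple forms of a class, \<open>m\<close> is bounded since \<open>m\<^sup>2 < D\<close>. Depending on the signs of \<open>Q(1, 1)\<close> and
  \<open>Q(1, -1)\<close>, one of the substitutions \<open>x \<mapsto> x \<plusminus> y\<close> or \<open>y \<mapsto> y \<plusminus> x\<close> leads to another simple form with \<open>m\<close>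
  changed by \<open>\<plusminus> 2 l\<close> or \<open>\<plusminus> 2 r\<close>. Minimality of \<open>m\<close>, respectively maximality, therefore determines both signs. In terms of the
  Farey tessellation, the first geodesic goes from \<open>]-1, 0[\<close> to \<open>]1, \<infinity>[\<close> and the second from \<open>]-\<infinity>, -1[\<close> to
  \<open>]0, 1[\<close>: the two ways of turning at the edge from \<open>0\<close> to \<open>\<infinity>\<close>.\<close>

lemma ex_extremal_simple_form:
  fixes Q :: "int bqf"
  assumes disc: "disc Q > 0" and nonsquare: "\<nexists>k. disc Q = k^2"
  shows "\<exists>l m r. psl2_equivalent Q (BQF l m r) \<and> 0 < l \<and> r < 0 \<and> l + m + r < 0 \<and> 0 < l - m + r"
    and "\<exists>l m r. psl2_equivalent Q (BQF l m r) \<and> 0 < l \<and> r < 0 \<and> 0 < l + m + r \<and> l - m + r < 0"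
proof -
  define S where "S P \<longleftrightarrow> psl2_equivalent Q P \<and> indefinite_simple P" for P
  obtain P0 where P0: "S P0" using ex_simple_form[OF assms] by (auto simp: S_def)
  have bound: "\<bar>coeff_xy P\<bar> < disc Q" if "S P" for P
  proof -
    have "(coeff_xy P)^2 - 4 * coeff_xx P * coeff_yy P = disc Q"
      using that disc_psl2_equivalent by (auto simp: S_def disc_def)
    moreover have "coeff_xx P * coeff_yy P < 0"
      using that by (simp add: S_def indefinite_simple_def mult_pos_neg)
    ultimately have "(coeff_xy P)^2 < disc Q" by simp
    moreover have "\<bar>coeff_xy P\<bar> \<le> (coeff_xy P)^2"
      by (metis abs_ge_zero int_one_le_iff_zero_less le_less mult_cancel_left1 power2_abs power2_eq_square self_le_power zero_less_numeral)
    ultimately show ?thesis by simp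
  qed
  have step: "S (BQF l m r) \<Longrightarrow> l > 0 \<and> r < 0 \<and> l + m + r \<noteq> 0 \<and> l - m + r \<noteq> 0" 
    "S (BQF l m r) \<Longrightarrow> l + m + r > 0 \<Longrightarrow> S (BQF (l + m + r) (m + 2 * r) r)"
    "S (BQF l m r) \<Longrightarrow> l + m + r < 0 \<Longrightarrow> S (BQF l (m + 2 * l) (l + m + r))"
    "S (BQF l m r) \<Longrightarrow> l - m + r > 0 \<Longrightarrow> S (BQF (l - m + r) (m - 2 * r) r)"
    "S (BQF l m r) \<Longrightarrow> l - m + r < 0 \<Longrightarrow> S (BQF l (m - 2 * l) (l - m + r))" for l m r
  proof -
    assume S: "S (BQF l m r)"
    then have QP: "psl2_equivalent Q (BQF l m r)" and lr: "l > 0" "r < 0"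
      by (simp_all add: S_def indefinite_simple_def)
    have "m^2 - 4 * l * r = disc Q" using disc_psl2_equivalent[OF QP] by (simp add: disc_def)
    then show "l > 0 \<and> r < 0 \<and> l + m + r \<noteq> 0 \<and> l - m + r \<noteq> 0"
      using no_unit_zero[of m l r] nonsquare lr by simp
    show "l + m + r > 0 \<Longrightarrow> S (BQF (l + m + r) (m + 2 * r) r)"
      "l + m + r < 0 \<Longrightarrow> S (BQF l (m + 2 * l) (l + m + r))"
      "l - m + r > 0 \<Longrightarrow> S (BQF (l - m + r) (m - 2 * r) r)"
      "l - m + r < 0 \<Longrightarrow> S (BQF l (m - 2 * l) (l - m + r))"
      using psl2_equivalent_trans[OF QP psl2_equivalent_steps(1), of 1]
        psl2_equivalent_trans[OF QP psl2_equivalent_steps(1), of "-1"]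
        psl2_equivalent_trans[OF QP psl2_equivalent_steps(2), of 1]
        psl2_equivalent_trans[OF QP psl2_equivalent_steps(2), of "-1"] lr
      by (simp_all add: S_def indefinite_simple_def algebra_simps)
  qed
  show "\<exists>l m r. psl2_equivalent Q (BQF l m r) \<and> 0 < l \<and> r < 0 \<and> l + m + r < 0 \<and> 0 < l - m + r"
  proof -
    obtain P where P: "S P" and least: "\<And>P'. S P' \<Longrightarrow> nat (coeff_xy P + disc Q) \<le> nat (coeff_xy P' + disc Q)"
      using ex_has_least_nat[of S P0 "\<lambda>P. nat (coeff_xy P + disc Q)"] P0 by metis
    obtain l m r where P': "P = BQF l m r" by (cases P)
    note S = P[unfolded P']
    have least': "m \<le> coeff_xy P'" if "S P'" for P'
      using least[OF that] bound[OF that] bound[OF P] by (simp add: P')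
    have "\<not> l + m + r > 0"
      using least'[OF step(2)[OF S]] step(1)[OF S] by auto
    moreover have "\<not> l - m + r < 0"
      using least'[OF step(5)[OF S]] step(1)[OF S] by auto
    ultimately show ?thesis using step(1)[OF S] S unfolding S_def by force
  qed
  show "\<exists>l m r. psl2_equivalent Q (BQF l m r) \<and> 0 < l \<and> r < 0 \<and> 0 < l + m + r \<and> l - m + r < 0"
  proof -
    obtain P where P: "S P" and least: "\<And>P'. S P' \<Longrightarrow> nat (disc Q - coeff_xy P) \<le> nat (disc Q - coeff_xy P')"
      using ex_has_least_nat[of S P0 "\<lambda>P. nat (disc Q - coeff_xy P)"] P0 by metis
    obtain l m r where P': "P = BQF l m r" by (cases P)
    note S = P[unfolded P']
    have greatest: "coeff_xy P' \<le> m" if "S P'" for P'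
      using least[OF that] bound[OF that] bound[OF P] by (simp add: P')
    have "\<not> l + m + r < 0"
      using greatest[OF step(3)[OF S]] step(1)[OF S] by auto
    moreover have "\<not> l - m + r > 0"
      using greatest[OF step(4)[OF S]] step(1)[OF S] by auto
    ultimately show ?thesis using step(1)[OF S] S unfolding S_def by force
  qed
qed

text \<open>A geodesic from \<open>]-1, 0[\<close> to \<open>]1, \<infinity>[\<close> crosses every geodesic from \<open>]-\<infinity>, -1[\<close> to \<open>]0, 1[\<close>, since the ends
  alternate.\<close>

lemma ex_crossing_lifts:
  fixes Qa Qb :: "int bqf"
  assumes disc: "disc Qa = \<Delta>" "disc Qb = \<Delta>" and \<Delta>: "\<Delta> > 0" "\<nexists>k. \<Delta> = k^2"
  shows "\<exists>P R. psl2_equivalent Qa P \<and> psl2_equivalent Qb R \<and> \<bar>polar P R\<bar> < \<Delta>"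
proof -
  obtain l m r where P: "psl2_equivalent Qa (BQF l m r)" "0 < l" "r < 0" "l + m + r < 0" "0 < l - m + r"
    using ex_extremal_simple_form(1)[of Qa] disc \<Delta> by auto
  obtain l' m' r' where R: "psl2_equivalent Qb (BQF l' m' r')" "0 < l'" "r' < 0" "0 < l' + m' + r'" "l' - m' + r' < 0"
    using ex_extremal_simple_form(2)[of Qb] disc \<Delta> by auto
  define A B C where "A = l * m' - l' * m" and "B = r * l' - r' * l" and "C = m * r' - m' * r"
  \<comment> \<open>\<open>4 (A C - B\<^sup>2) = \<Delta>\<^sup>2 - c\<^sup>2\<close>, so crossing means \<open>B\<^sup>2 < A C\<close>; in fact both \<open>A\<close> and \<open>C\<close> exceed \<open>\<bar>B\<bar>\<close>\<close>
  have ineq: "l * (l' + r') < l * m'" "l * (- (l' + r')) < l * m'"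
    "l' * (l + r) < l' * (- m)" "l' * (- (l + r)) < l' * (- m)"
    "(- r') * (l + r) < (- r') * (- m)" "(- r') * (- (l + r)) < (- r') * (- m)"
    "(- r) * (l' + r') < (- r) * m'" "(- r) * (- (l' + r')) < (- r) * m'"
    using P R by (intro mult_strict_left_mono; simp)+
  have "\<bar>B\<bar> < A" "\<bar>B\<bar> < C"
    using ineq unfolding A_def B_def C_def by (simp_all add: abs_less_iff algebra_simps)
  then have "\<bar>B\<bar> * \<bar>B\<bar> < A * C" by (intro mult_strict_mono') auto
  moreover have "4 * (A * C - B^2)
      = disc (BQF l m r) * disc (BQF l' m' r') - (polar (BQF l m r) (BQF l' m' r'))^2"
    unfolding A_def B_def C_def by (simp add: disc_def polar_def power2_eq_square algebra_simps)
  moreover have "disc (BQF l m r) = \<Delta>" "disc (BQF l' m' r') = \<Delta>"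
    using disc_psl2_equivalent[OF P(1)] disc_psl2_equivalent[OF R(1)] disc by simp_all
  ultimately have "(polar (BQF l m r) (BQF l' m' r'))^2 < \<Delta>^2"
    by (simp add: power2_eq_square)
  then have "\<bar>polar (BQF l m r) (BQF l' m' r')\<bar> < \<Delta>"
    using \<Delta>(1) by (metis abs_of_pos power2_less_imp_less abs_ge_zero power2_abs)
  then show ?thesis using P(1) R(1) by blast
qed

text \<open>Translating \<open>R = l' x\<^sup>2 + m' x y + r' y\<^sup>2\<close> by \<open>k\<close> makes the polar form a quadratic polynomial in \<open>k\<close> with leading
  coefficient \<open>- 2 l l'\<close>. This is positive when the leading coefficients have opposite signs, that is, when the
  geodesics run in opposite horizontal directions.\<close>

lemma ex_distant_lifts:
  fixes Qa Qb :: "int bqf"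
  assumes disc: "disc Qa = \<Delta>" "disc Qb = \<Delta>" and \<Delta>: "\<Delta> > 0" "\<nexists>k. \<Delta> = k^2"
  shows "\<exists>P R. psl2_equivalent Qa P \<and> psl2_equivalent Qb R \<and> polar P R > \<Delta> \<and>
    coeff_xx P * coeff_xy R \<noteq> coeff_xx R * coeff_xy P"
proof -
  obtain l m r where P: "psl2_equivalent Qa (BQF l m r)" "0 < l" "r < 0"
    using ex_extremal_simple_form(1)[of Qa] disc \<Delta> by auto
  obtain l1 m1 r1 where R1: "psl2_equivalent Qb (BQF l1 m1 r1)" "0 < l1" "r1 < 0"
    using ex_extremal_simple_form(1)[of Qb] disc \<Delta> by auto
  define l' m' r' where "l' = r1" and "m' = - m1" and "r' = l1"
  have R: "psl2_equivalent Qb (BQF l' m' r')" "l' < 0"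
    using psl2_equivalent_trans[OF R1(1) psl2_equivalent_steps(3)] R1(3) by (simp_all add: l'_def m'_def r'_def)
  define e f g h where "e = 2 * (l * - l')" and "f = 2 * m * l' - 2 * l * m'"
    and "g = m * m' - 2 * r * l' - 2 * l * r'" and "h = l * m' - l' * m"
  \<comment> \<open>large enough to absorb the lower order terms of both \<open>c\<close> and the Jacobian\<close>
  define k where "k = \<bar>f\<bar> + \<bar>g\<bar> + \<bar>h\<bar> + \<Delta> + 1"
  define R where "R = BQF l' (m' + 2 * l' * k) (l' * k^2 + m' * k + r')"
  have e: "e \<ge> 2" using mult_pos_pos[of l "- l'"] P(2) R(2) unfolding e_def by linarith
  have k: "k \<ge> 1" "\<bar>f\<bar> + 1 \<le> k" using \<Delta> by (simp_all add: k_def)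
  have "polar (BQF l m r) R = e * k^2 + f * k + g"
    by (simp add: polar_def R_def e_def f_def g_def power2_eq_square algebra_simps)
  moreover have "2 * k^2 \<le> e * k^2" using e by (simp add: mult_right_mono)
  moreover have "- \<bar>f\<bar> * k \<le> f * k" using k by (intro mult_right_mono) auto
  moreover have "1 * k \<le> (2 * k - \<bar>f\<bar>) * k" using k by (intro mult_right_mono) auto
  ultimately have "polar (BQF l m r) R \<ge> k + g"
    by (simp add: power2_eq_square algebra_simps)
  then have "polar (BQF l m r) R > \<Delta>" by (simp add: k_def abs_if split: if_splits)
  moreover have "l * (m' + 2 * l' * k) - l' * m = h - e * k"
    by (simp add: h_def e_def algebra_simps)
  moreover have "2 * k \<le> e * k" using e k by (intro mult_right_mono) auto
  then have "h - e * k < 0" using \<Delta> by (simp add: k_def)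
  ultimately have "polar (BQF l m r) R > \<Delta> \<and> coeff_xx (BQF l m r) * coeff_xy R \<noteq> coeff_xx R * coeff_xy (BQF l m r)"
    by (simp add: R_def)
  moreover have "psl2_equivalent Qb R"
    unfolding R_def by (rule psl2_equivalent_trans[OF R(1) psl2_equivalent_steps(1)])
  ultimately show ?thesis using P(1) by blast
qed

section \<open>The criterion for one pair of lifts and its independence of the pair\<close>

lemma equals_in_field_iff:
  assumes "(of_int d :: 'k::field) \<noteq> 0"
  shows "equals_in_field (of_int n / of_int d) (k :: 'k) \<longleftrightarrow> k = of_int n / of_int d"
proof
  assume "equals_in_field (of_int n / of_int d) k"
  then obtain a b :: int where b: "(of_int b :: 'k) \<noteq> 0" and eq: "of_int n / of_int d = (of_int a / of_int b :: real)"
    and k: "k = of_int a / of_int b"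
    by (auto simp: equals_in_field_def)
  have "b \<noteq> 0" "d \<noteq> 0" using b assms by auto
  then have "real_of_int (n * b) = real_of_int (a * d)" using eq by (simp add: frac_eq_eq)
  then have "n * b = a * d" by (simp only: of_int_eq_iff)
  then have "(of_int n * of_int b :: 'k) = of_int a * of_int d" by (metis of_int_mult)
  then show "k = of_int n / of_int d" using b assms by (simp add: k frac_eq_eq)
next
  assume "k = of_int n / of_int d"
  then show "equals_in_field (of_int n / of_int d) k"
    using assms by (auto simp: equals_in_field_def)
qed

text \<open>The criterion for a single pair of lifts. The number \<open>u\<close> stands for \<open>cos\<^sup>2 (\<theta>/2)\<close> or \<open>cosh\<^sup>2 (\<lambda>/2)\<close>; its positivity
  excludes \<open>n = 0\<close> in characteristic 0.\<close>

lemma K_equivalent_iff_of_pair: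
  fixes Qa Qb P R :: "int bqf"
  assumes disc: "disc Qa = \<Delta>" "disc Qb = \<Delta>"
    and char: "CHAR('k::field) \<noteq> 2" and \<Delta>: "(of_int \<Delta> :: 'k) \<noteq> 0" "\<Delta> > 0"
    and P: "psl2_equivalent Qa P" and R: "psl2_equivalent Qb R"
    and u: "u = (1 + of_int (polar P R) / of_int \<Delta>) / 2" "u > 0"
  shows "K_equivalent TYPE('k) Qa Qb \<longleftrightarrow>
    (\<exists>x y :: 'k. equals_in_field u (1 / ((2 * x)^2 - of_int \<Delta> * y^2)))"
proof -
  have discPR: "disc P = \<Delta>" "disc R = \<Delta>"
    using disc_psl2_equivalent[OF P] disc_psl2_equivalent[OF R] disc by simp_all
  have "even (\<Delta> + polar P R)"
  proof -
    have "even (disc Q) \<longleftrightarrow> even (coeff_xy Q)" for Q :: "int bqf"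
      by (simp add: disc_def)
    from this[of P] this[of R] show ?thesis by (simp add: discPR polar_def)
  qed
  then obtain n where n: "\<Delta> + polar P R = 2 * n" by blast
  have "real_of_int (\<Delta> + polar P R) = 2 * of_int n" unfolding n by simp
  then have un: "u = of_int n / of_int \<Delta>" using \<Delta>(2) unfolding u(1) by (simp add: field_simps)
  then have "n > 0" using u(2) \<Delta>(2) by (simp add: zero_less_divide_iff)
  have two: "(2::'k) \<noteq> 0" using char by (rule two_neq_0_if_CHAR)
  define p q where "p = (map_bqf of_int P :: 'k bqf)" and "q = (map_bqf of_int R :: 'k bqf)"
  have pq: "disc p = of_int \<Delta>" "disc q = of_int \<Delta>" "2 * of_int n = of_int \<Delta> + polar p q"
    using arg_cong[OF n, of "of_int :: int \<Rightarrow> 'k"]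
    by (simp_all add: p_def q_def disc_map_bqf polar_map_bqf discPR)
  have K: "K_equivalent TYPE('k) Qa Qb \<longleftrightarrow> psl2_equivalent p q"
    unfolding K_equivalent_def p_def q_def
    using psl2_equivalent_map_bqf[OF P, where 'k = 'k] psl2_equivalent_map_bqf[OF R, where 'k = 'k]
      psl2_equivalent_sym psl2_equivalent_trans by blast
  show ?thesis
  proof (cases "(of_int n :: 'k) = 0")
    case True
    have "CHAR('k) > 0"
    proof (rule ccontr)
      assume "\<not> CHAR('k) > 0"
      then have "CHAR('k) = 0" by blast
      then show False using True \<open>n > 0\<close> unfolding of_int_eq_0_iff_char_dvd by simp
    qed
    then have "K_equivalent TYPE('k) Qa Qb"
      by (rule K_equivalent_finite_char[OF _ char disc \<Delta>(1)])
    moreover have "equals_in_field u (1 / ((2 * 0)^2 - of_int \<Delta> * 0^2) :: 'k)"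
      unfolding un equals_in_field_iff[OF \<Delta>(1)] by (simp add: True)
    ultimately show ?thesis by blast
  next
    case False
    then show ?thesis
      unfolding K psl2_equivalent_iff_norm[OF pq(1,2) two pq(3) False \<Delta>(1)] un equals_in_field_iff[OF \<Delta>(1)]
      by metis
  qed
qed

lemma cosh_half_squared: "(cosh (x / 2))^2 = (1 + cosh x) / (2::real)"
  using cosh_double_cosh[of "x / 2"] by simp

lemma criterion_independent_of_witness:
  assumes "\<And>I t. I \<in> S \<Longrightarrow> h I t \<Longrightarrow> K \<longleftrightarrow> \<Phi> t" and "\<exists>I \<in> S. \<exists>t. h I t"
  shows "(K \<longleftrightarrow> (\<exists>I \<in> S. \<exists>t. h I t \<and> \<Phi> t)) \<and> (K \<longrightarrow> (\<forall>I \<in> S. \<forall>t. h I t \<longrightarrow> \<Phi> t))"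
  using assms by blast

theorem mainTheorem6:
  fixes Qa Qb :: "int bqf" and \<Delta> :: int
  assumes "primitive Qa" and "primitive Qb"
    and "disc Qa = \<Delta>" and "disc Qb = \<Delta>"
    and "\<Delta> > 0" and "\<nexists>k. \<Delta> = k^2"
    and "CHAR('k::field) \<noteq> 2"
    and "(of_int \<Delta> :: 'k) \<noteq> 0"
  shows
    "(K_equivalent TYPE('k) Qa Qb \<longleftrightarrow>
        (\<exists>I \<in> intersection_points Qa Qb. \<exists>\<theta>. has_angle I \<theta> \<and>
          (\<exists>x y :: 'k.
             equals_in_field ((cos (\<theta> / 2))^2) (1 / ((2 * x)^2 - of_int \<Delta> * y^2)))))
   \<and> (K_equivalent TYPE('k) Qa Qb \<longrightarrow>
        (\<forall>I \<in> intersection_points Qa Qb. \<forall>\<theta>. has_angle I \<theta> \<longrightarrow>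
          (\<exists>x y :: 'k.
             equals_in_field ((cos (\<theta> / 2))^2) (1 / ((2 * x)^2 - of_int \<Delta> * y^2)))))
   \<and> (K_equivalent TYPE('k) Qa Qb \<longleftrightarrow>
        (\<exists>I \<in> cooriented_orthogeodesics Qa Qb. \<exists>ell. has_length I ell \<and>
          (\<exists>x y :: 'k.
             equals_in_field ((cosh (ell / 2))^2) (1 / ((2 * x)^2 - of_int \<Delta> * y^2)))))
   \<and> (K_equivalent TYPE('k) Qa Qb \<longrightarrow>
        (\<forall>I \<in> cooriented_orthogeodesics Qa Qb. \<forall>ell. has_length I ell \<longrightarrow>
          (\<exists>x y :: 'k.
             equals_in_field ((cosh (ell / 2))^2) (1 / ((2 * x)^2 - of_int \<Delta> * y^2)))))"
proof -
  note disc = assms(3,4) and \<Delta> = assms(5,6)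
  have points: "(\<exists>I \<in> intersection_points Qa Qb. has_angle I \<theta>)
      \<longleftrightarrow> (\<exists>P R. psl2_equivalent Qa P \<and> psl2_equivalent Qb R \<and> crossing_angle (form_ends P) (form_ends R) \<theta>)"
    for \<theta>
    unfolding intersection_points_def has_angle_def
    by (rule orbits_of_pairs_of_lifts) (simp_all only: disc \<Delta> not_False_eq_True)
  have orthos: "(\<exists>I \<in> cooriented_orthogeodesics Qa Qb. has_length I ell)
      \<longleftrightarrow> (\<exists>P R. psl2_equivalent Qa P \<and> psl2_equivalent Qb R \<and> cooriented_perpendicular (form_ends P) (form_ends R) ell)"
    for ell
    unfolding cooriented_orthogeodesics_def has_length_def
    by (rule orbits_of_pairs_of_lifts) (simp_all only: disc \<Delta> not_False_eq_True)
  have lift: "coeff_xx (map_bqf real_of_int P) \<noteq> 0 \<and> disc (map_bqf real_of_int P) = of_int \<Delta>"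
    if "psl2_equivalent Qa P \<or> psl2_equivalent Qb P" for P
  proof -
    have "disc P = \<Delta>" using that disc disc_psl2_equivalent by metis
    then show ?thesis using coeff_xx_nonzero[of P] \<Delta>(2) by (simp add: disc_map_bqf)
  qed
  have rD: "real_of_int \<Delta> > 0" using \<Delta> by simp

  have angle: "K_equivalent TYPE('k) Qa Qb \<longleftrightarrow>
      (\<exists>x y :: 'k. equals_in_field ((cos (\<theta> / 2))^2) (1 / ((2 * x)^2 - of_int \<Delta> * y^2)))"
    if "I \<in> intersection_points Qa Qb" "has_angle I \<theta>" for I \<theta>
  proof -
    have "\<exists>I \<in> intersection_points Qa Qb. has_angle I \<theta>" using that by blast
    then obtain P R where P: "psl2_equivalent Qa P" and R: "psl2_equivalent Qb R"
      and \<theta>: "crossing_angle (ends (map_bqf of_int P)) (ends (map_bqf of_int R)) \<theta>"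
      unfolding points form_ends_eq_ends by blast
    have "cos \<theta> = of_int (polar P R) / of_int \<Delta>"
      using cos_crossing_angle[OF \<theta>] lift[of P] lift[of R] P R rD by (simp add: polar_map_bqf)
    then have "(cos (\<theta> / 2))^2 = (1 + of_int (polar P R) / of_int \<Delta>) / 2"
      using cos_double_cos[of "\<theta> / 2"] by simp
    moreover have "cos (\<theta> / 2) > 0"
      using \<theta> by (intro cos_gt_zero_pi) (auto simp: crossing_angle_def)
    then have "(cos (\<theta> / 2))^2 > 0" by simp
    ultimately show ?thesis
      by (rule K_equivalent_iff_of_pair[OF disc assms(7,8) \<Delta>(1) P R])
  qed
  have ex_angle: "\<exists>I \<in> intersection_points Qa Qb. \<exists>\<theta>. has_angle I \<theta>"
  proof -
    obtain P R where P: "psl2_equivalent Qa P" and R: "psl2_equivalent Qb R" and lt: "\<bar>polar P R\<bar> < \<Delta>"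
      using ex_crossing_lifts[OF disc \<Delta>] by blast
    have "real_of_int \<bar>polar P R\<bar> < of_int \<Delta>" using lt by (simp only: of_int_less_iff)
    then have "\<exists>\<theta>. crossing_angle (form_ends P) (form_ends R) \<theta>"
      unfolding form_ends_eq_ends
      using lift[of P] lift[of R] P R rD by (intro ex_crossing_angle) (auto simp: polar_map_bqf)
    then obtain \<theta> where "crossing_angle (form_ends P) (form_ends R) \<theta>" by blast
    with P R have "\<exists>I \<in> intersection_points Qa Qb. has_angle I \<theta>" unfolding points by blast
    then show ?thesis by blast
  qed
  have len: "K_equivalent TYPE('k) Qa Qb \<longleftrightarrow>
      (\<exists>x y :: 'k. equals_in_field ((cosh (ell / 2))^2) (1 / ((2 * x)^2 - of_int \<Delta> * y^2)))"
    if "I \<in> cooriented_orthogeodesics Qa Qb" "has_length I ell" for I ell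
  proof -
    have "\<exists>I \<in> cooriented_orthogeodesics Qa Qb. has_length I ell" using that by blast
    then obtain P R where P: "psl2_equivalent Qa P" and R: "psl2_equivalent Qb R"
      and ell: "cooriented_perpendicular (ends (map_bqf of_int P)) (ends (map_bqf of_int R)) ell"
      unfolding orthos form_ends_eq_ends by blast
    have "cosh ell = of_int (polar P R) / of_int \<Delta>"
      using cosh_cooriented_perpendicular[OF ell] lift[of P] lift[of R] P R rD by (simp add: polar_map_bqf)
    then have "(cosh (ell / 2))^2 = (1 + of_int (polar P R) / of_int \<Delta>) / 2"
      by (simp add: cosh_half_squared)
    moreover have "(cosh (ell / 2))^2 > 0" by simp
    ultimately show ?thesis
      by (rule K_equivalent_iff_of_pair[OF disc assms(7,8) \<Delta>(1) P R])
  qed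
  have ex_len: "\<exists>I \<in> cooriented_orthogeodesics Qa Qb. \<exists>ell. has_length I ell"
  proof -
    obtain P R where P: "psl2_equivalent Qa P" and R: "psl2_equivalent Qb R" and gt: "polar P R > \<Delta>"
      and J: "coeff_xx P * coeff_xy R \<noteq> coeff_xx R * coeff_xy P"
      using ex_distant_lifts[OF disc \<Delta>] by blast
    have "coeff_xx (jacobian (map_bqf of_int P) (map_bqf of_int R)) \<noteq> 0"
      using J by (simp add: jacobian_def flip: of_int_mult)
    then have "\<exists>ell. cooriented_perpendicular (form_ends P) (form_ends R) ell"
      unfolding form_ends_eq_ends
      using lift[of P] lift[of R] P R rD gt by (intro ex_cooriented_perpendicular) (auto simp: polar_map_bqf)
    then obtain ell where "cooriented_perpendicular (form_ends P) (form_ends R) ell" by blast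
    with P R have "\<exists>I \<in> cooriented_orthogeodesics Qa Qb. has_length I ell" unfolding orthos by blast
    then show ?thesis by blast
  qed
  note by_angle = criterion_independent_of_witness[OF angle ex_angle]
    and by_length = criterion_independent_of_witness[OF len ex_len]
  show ?thesis
    by (intro conjI by_angle[THEN conjunct1] by_angle[THEN conjunct2]
        by_length[THEN conjunct1] by_length[THEN conjunct2])
qed

end
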